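(* Let $C>0$, $G\geq 0$, $M\geq 0$ and $0<Y<2$, and set $\theta=(G-M)/2$ and $\tilde\theta=(G+M)/2$. Let $\mathcal{T}=\{\mathcal{T}(t),t\geq 0\}$ be the subordinator (increasing L\'evy process with $\mathcal{T}(0)=0$, zero drift) with L\'evy density $$\nu_{\mathcal{T}}(x)=C\frac{2^{Y/2-1}\Gamma(Y/2)}{\Gamma(Y)}\frac{e^{-(\tilde{\theta}^2-\theta^2)x/2}}{x^{1+Y/2}}\,{\rm E}\left[\exp\left(-\frac{\tilde{\theta}^2x}{2}\frac{\gamma_{Y/2}}{\gamma_{1/2}}\right)\right],\qquad x>0,$$ where $\gamma_{Y/2}$ and $\gamma_{1/2}$ are independent gamma random variables with unit scale and shapes $Y/2$ and $1/2$ respectively. Fix $t>0$, put $\widetilde{C}:=tC2^{Y/2-1}/\Gamma(Y)$, and let $\mathcal{R}:=\gamma_{Y/2}/\gamma_{1/2}$. Then for every $L>0$, $\mathcal{T}(t)$ admits the decomposition $$\mathcal{T}(t)=\mathcal{T}_L(t)+\epsilon_L(t),$$ where $\mathcal{T}_L(t)$ and $\epsilon_L(t)$ are independent nonnegative random variables with the following properties: (i) $\mathcal{T}_L(t)$ is a generalized gamma convolution random variable with Laplace exponent $$-\log\left({\rm E}\left[e^{-\mu\mathcal{T}_L(t)}\right]\right)=\frac{2\widetilde{C}L^{Y/2}}{Y}\,{\rm E}\left[\log\left(1+\mu R\right)\right],\qquad \mu>0,$$ where $$R:=\frac{1}{\frac{GM+\tilde{\theta}^2\mathcal{R}}{2}+\mathcal{Z}},$$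 with $\mathcal{Z}$ independent of $\mathcal{R}$ and having probability density $f_{\mathcal{Z}}(z)=\frac{Y}{2}L^{-Y/2}z^{Y/2-1}$ for $0\leq z\leq L$; (ii) the standardized variable $(\epsilon_L(t)-{\rm E}[\epsilon_L(t)])/\sqrt{{\rm Var}(\epsilon_L(t))}$ converges in distribution to a standard normal random variable as $L\to\infty$, and $${\rm E}[\epsilon_L(t)^2]\leq\frac{\widetilde{C}^2}{(1-Y/2)^2L^{2-Y}}+\frac{\widetilde{C}}{(2-Y/2)L^{2-Y/2}}.$$
   Context: A CGMY process with parameters $C>0,G\geq0,M\geq0,0<Y<2$ is the pure-jump L\'evy process with L\'evy density $C\left(\frac{e^{-G|x|}}{|x|^{1+Y}}I\{x<0\}+\frac{e^{-Mx}}{x^{1+Y}}I\{x>0\}\right)$; it can be represented as $X(t)=\theta\mathcal{T}(t)+W(\mathcal{T}(t))$ with $W$ a standard Brownian motion independent of the subordinator $\mathcal{T}$ described in the claim (the "time change"). A generalized gamma convolution random variable is a nonnegative infinitely divisible random variable whose Laplace exponent has the form $\int_{(0,\infty)}\log(1+\mu/s)\,U(ds)$ (plus possibly a linear drift term) for some nonnegative measure $U$ (Thorin measure). The decomposition is meant in distribution: the law of $\mathcal{T}(t)$ equals the law of the sum of the independent variables $\mathcal{T}_L(t)$ and $\epsilon_L(t)$ (so the law of $\epsilon_L(t)$ is determined by those of $\mathcal{T}(t)$ and $\mathcal{T}_L(t)$). *)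

theory Defs
  imports "HOL-Probability.Probability"
begin

definition gamma_density :: "real \<Rightarrow> real \<Rightarrow> real" where
  "gamma_density k x = (if x > 0 then x powr (k - 1) * exp (- x) / Gamma k else 0)"

definition gamma_law :: "real \<Rightarrow> real measure" where
  "gamma_law k = density lborel (\<lambda>x. ennreal (gamma_density k x))"

definition ratio_law :: "real \<Rightarrow> real measure" where
  "ratio_law Y = distr (gamma_law (Y/2) \<Otimes>\<^sub>M gamma_law (1/2)) borel (\<lambda>(u, v). u / v)"

definition nu_T :: "real \<Rightarrow> real \<Rightarrow> real \<Rightarrow> real \<Rightarrow> real \<Rightarrow> real" where
  "nu_T C G M Y x =
     (let \<theta> = (G - M) / 2; \<theta>t = (G + M) / 2 in
      C * (2 powr (Y/2 - 1) * Gamma (Y/2) / Gamma Y)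
        * exp (- (\<theta>t\<^sup>2 - \<theta>\<^sup>2) * x / 2) / x powr (1 + Y/2)
        * (\<integral>r. exp (- (\<theta>t\<^sup>2 * x / 2) * r) \<partial>ratio_law Y))"

definition nonneg_law :: "real measure \<Rightarrow> bool" where
  "nonneg_law P \<longleftrightarrow> prob_space P \<and> sets P = sets borel \<and> (AE x in P. 0 \<le> x)"

definition laplace :: "real measure \<Rightarrow> real \<Rightarrow> real" where
  "laplace P \<mu> = (\<integral>x. exp (- \<mu> * x) \<partial>P)"

definition subordinator_law :: "(real \<Rightarrow> real) \<Rightarrow> real \<Rightarrow> real measure \<Rightarrow> bool" where
  "subordinator_law \<nu> t P \<longleftrightarrow> nonneg_law P \<and>
     (\<forall>\<mu>>0. laplace P \<mu> = exp (- t * (LINT x:{0<..}|lborel. (1 - exp (- \<mu> * x)) * \<nu> x)))"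

definition ggc :: "real measure \<Rightarrow> bool" where
  "ggc P \<longleftrightarrow> nonneg_law P \<and>
     (\<exists>a\<ge>0. \<exists>U. sets U = sets borel \<and>
        (\<forall>\<mu>>0. ennreal (- ln (laplace P \<mu>)) =
           ennreal (a * \<mu>) + (\<integral>\<^sup>+ s. indicator {0<..} s * ennreal (ln (1 + \<mu> / s)) \<partial>U)))"

definition Z_law :: "real \<Rightarrow> real \<Rightarrow> real measure" where
  "Z_law Y L = density lborel
     (\<lambda>z. ennreal (indicator {0..L} z * (Y/2) * L powr (- Y/2) * z powr (Y/2 - 1)))"

definition R_law :: "real \<Rightarrow> real \<Rightarrow> real \<Rightarrow> real \<Rightarrow> real measure" where
  "R_law G M Y L = distr (ratio_law Y \<Otimes>\<^sub>M Z_law Y L) borel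
     (\<lambda>(r, z). 1 / ((G * M + ((G + M) / 2)\<^sup>2 * r) / 2 + z))"

definition mean :: "real measure \<Rightarrow> real" where
  "mean P = (\<integral>x. x \<partial>P)"

definition var :: "real measure \<Rightarrow> real" where
  "var P = (\<integral>x. (x - mean P)\<^sup>2 \<partial>P)"

definition standardize :: "real measure \<Rightarrow> real measure" where
  "standardize P = distr P borel (\<lambda>x. (x - mean P) / sqrt (var P))"

end

theory Submission
  imports Defs
begin

text \<open>Writing \<open>\<Gamma>(Y/2) x powr (- Y/2)\<close> as the integral of \<open>z powr (Y/2 - 1) * exp (- z x)\<close> over
  \<open>z > 0\<close> turns the Levy density of \<open>T(t)\<close> into a mixture of \<open>exp (- s x) / x\<close> with
  \<open>s = (G M + \<theta>\<^sup>2 r) / 2 + z\<close>, that is, a Thorin representation. The part \<open>z \<le> L\<close> is the Levy measure of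
  the gamma convolution and the part \<open>z > L\<close> that of the remainder; Frullani's integral gives the
  logarithmic exponent. Both laws exist as weak limits of convolution powers (compound Poisson
  approximation), and uniqueness of Laplace transforms identifies their convolution with the given
  law. The \<open>k\<close>-th cumulant of the remainder is \<open>(k - 1)!\<close> times the integral of \<open>s\<close> to the power
  \<open>- k\<close>, hence at most of order \<open>L powr (Y/2 - k)\<close>; for \<open>k = 2\<close> this order is attained, so the
  skewness is \<open>O(L powr (- Y/4))\<close> and the standardized remainder is asymptotically normal.\<close>

section \<open>Laplace transforms of laws on the half-line\<close>

text \<open>The transform is taken at complex arguments with nonnegative real part because one
  existence proof serves two ends: real arguments give the logarithmic exponent and identify the
  convolution with the given law, imaginary ones give the characteristic function for the normal
  limit. The given law is known only through its Laplace transform, so both summands have to be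
  built from their Levy measures. The delicate case is \<open>G * M = 0\<close>: for
  \<open>G = M = 0\<close> the reciprocal of R is just Z, rates come arbitrarily close to 0, and
  T(t) has infinite mean. Moments are therefore computed for the remainder alone, whose rates stay
  above L, and the upper bounds simply discard the nonnegative contribution of the ratio to the
  rate. The lower bound on the variance cannot discard it and cannot average it either, since the
  ratio of the two gamma variables has infinite mean (the denominator has shape 1/2); a quantile of
  the ratio takes the place of its mean. Integrals over the mixing measure stay in
  \<open>ennreal\<close>, where Tonelli applies freely, until finiteness has been
  established.\<close>

definition claplace :: "real measure \<Rightarrow> complex \<Rightarrow> complex" where
  "claplace P w = (\<integral>x. exp (- (w * complex_of_real x)) \<partial>P)"

lemma nonneg_law_real_distribution: "nonneg_law P \<Longrightarrow> real_distribution P"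
  by (simp add: nonneg_law_def real_distribution_def real_distribution_axioms_def)

lemma norm_exp_neg_le_1:
  assumes "0 \<le> Re w" "0 \<le> x"
  shows "norm (exp (- (w * complex_of_real x))) \<le> 1"
  using assms by (simp add: norm_exp_eq_Re)

lemma integrable_claplace:
  assumes "nonneg_law P" "0 \<le> Re w"
  shows "integrable P (\<lambda>x. exp (- (w * complex_of_real x)))"
proof -
  interpret real_distribution P using assms(1) by (rule nonneg_law_real_distribution)
  have "AE x in P. norm (exp (- (w * complex_of_real x))) \<le> 1"
    using assms norm_exp_neg_le_1 by (auto simp: nonneg_law_def)
  then show ?thesis by (intro integrable_const_bound[where B=1]) auto
qed

lemma norm_claplace_le_1:
  assumes "nonneg_law P" "0 \<le> Re w"
  shows "norm (claplace P w) \<le> 1"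
proof -
  interpret real_distribution P using assms(1) by (rule nonneg_law_real_distribution)
  have "AE x in P. norm (exp (- (w * complex_of_real x))) \<le> 1"
    using assms norm_exp_neg_le_1 by (auto simp: nonneg_law_def)
  then have "(\<integral>x. norm (exp (- (w * complex_of_real x))) \<partial>P) \<le> (\<integral>x. 1 \<partial>P)"
    by (intro integral_mono_AE integrable_norm integrable_claplace assms) auto
  then show ?thesis
    unfolding claplace_def using integral_norm_bound[of P "\<lambda>x. exp (- (w * complex_of_real x))"]
    by (simp add: prob_space del: space_eq_univ)
qed

lemma of_real_laplace: "complex_of_real (laplace P \<mu>) = claplace P (complex_of_real \<mu>)"
  unfolding laplace_def claplace_def integral_complex_of_real[symmetric]
  by (intro Bochner_Integration.integral_cong) (auto simp flip: exp_of_real)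

lemma char_eq_claplace: "char P u = claplace P (- (\<i> * complex_of_real u))"
  unfolding char_def claplace_def by (simp add: mult.assoc)

lemma nonneg_law_convolution:
  assumes "nonneg_law P" "nonneg_law Q"
  shows "nonneg_law (P \<star> Q)"
proof -
  interpret P: real_distribution P using assms(1) by (rule nonneg_law_real_distribution)
  interpret Q: real_distribution Q using assms(2) by (rule nonneg_law_real_distribution)
  interpret PQ: pair_prob_space P Q ..
  have "AE z in P \<Otimes>\<^sub>M Q. 0 \<le> fst z + snd z"
  proof (rule PQ.AE_pair_measure)
    show "AE x in P. AE y in Q. 0 \<le> fst (x, y) + snd (x, y)"
      using assms by (auto simp: nonneg_law_def)
  qed measurable
  then show ?thesis
    unfolding nonneg_law_def convolution_def
    by (auto intro!: PQ.prob_space_distr simp: AE_distr_iff case_prod_beta')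
qed

lemma claplace_convolution:
  assumes "nonneg_law P" "nonneg_law Q" "0 \<le> Re w"
  shows "claplace (P \<star> Q) w = claplace P w * claplace Q w"
proof -
  interpret P: real_distribution P using assms(1) by (rule nonneg_law_real_distribution)
  interpret Q: real_distribution Q using assms(2) by (rule nonneg_law_real_distribution)
  interpret PQ: pair_prob_space P Q ..
  let ?e = "\<lambda>x. exp (- (w * complex_of_real x))"
  have AE: "AE z in P \<Otimes>\<^sub>M Q. norm (?e (fst z + snd z)) \<le> 1"
  proof (rule PQ.AE_pair_measure)
    show "AE x in P. AE y in Q. norm (?e (fst (x, y) + snd (x, y))) \<le> 1"
      using assms(1,2) norm_exp_neg_le_1[OF assms(3)]
      by (auto simp: nonneg_law_def simp del: norm_exp_eq_Re of_real_add)
  qed measurable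
  have int: "integrable (P \<Otimes>\<^sub>M Q) (\<lambda>z. ?e (fst z + snd z))"
    using AE by (intro PQ.integrable_const_bound[where B=1]) auto
  have "claplace (P \<star> Q) w = (\<integral>z. ?e (fst z + snd z) \<partial>(P \<Otimes>\<^sub>M Q))"
    unfolding claplace_def convolution_def
    by (subst integral_distr) (auto simp: case_prod_beta')
  also have "\<dots> = (\<integral>x. (\<integral>y. ?e (x + y) \<partial>Q) \<partial>P)"
    by (subst PQ.integral_fst'[symmetric, OF int]) simp
  also have "\<dots> = (\<integral>x. ?e x * (\<integral>y. ?e y \<partial>Q) \<partial>P)"
    by (simp add: distrib_left exp_add exp_diff exp_minus divide_inverse)
  also have "\<dots> = claplace P w * claplace Q w"
    by (simp add: claplace_def)
  finally show ?thesis .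
qed

primrec convpow :: "real measure \<Rightarrow> nat \<Rightarrow> real measure" where
  "convpow F 0 = return borel 0"
| "convpow F (Suc n) = (F \<star> convpow F n)"

lemma nonneg_law_return_0: "nonneg_law (return borel 0)"
  by (auto simp: nonneg_law_def AE_return intro!: prob_space_return)

lemma nonneg_law_convpow: "nonneg_law F \<Longrightarrow> nonneg_law (convpow F n)"
  by (induction n) (auto intro: nonneg_law_convolution nonneg_law_return_0)

lemma claplace_convpow:
  "nonneg_law F \<Longrightarrow> 0 \<le> Re w \<Longrightarrow> claplace (convpow F n) w = claplace F w ^ n"
proof (induction n)
  case 0
  then show ?case by (simp add: claplace_def integral_return)
next
  case (Suc n)
  then show ?case by (simp add: claplace_convolution nonneg_law_convpow)
qed

lemma laplace_convolution:
  assumes "nonneg_law P" "nonneg_law Q" "0 \<le> \<mu>"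
  shows "laplace (P \<star> Q) \<mu> = laplace P \<mu> * laplace Q \<mu>"
proof -
  have "complex_of_real (laplace (P \<star> Q) \<mu>) = complex_of_real (laplace P \<mu> * laplace Q \<mu>)"
    using assms by (simp add: of_real_laplace claplace_convolution)
  then show ?thesis by (simp only: of_real_eq_iff)
qed

text \<open>The moments of a law on the unit interval determine its characteristic function; the
  substitution \<open>y = exp (- x)\<close> turns the Laplace transform at the integers into such moments.\<close>

lemma real_distribution_unit_interval_eqI:
  assumes "real_distribution P" "real_distribution Q"
    and "AE x in P. x \<in> {0..1}" "AE x in Q. x \<in> {0..1}"
    and eq: "\<And>k. (\<integral>x. x ^ k \<partial>P) = (\<integral>x. x ^ k \<partial>Q)"
  shows "P = Q"
proof (rule Levy_uniqueness[OF assms(1,2)], rule ext)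
  fix t
  have conv: "(\<lambda>n. \<Sum>k\<le>n. ((\<i> * t)^k / fact k) * (\<integral>x. x ^ k \<partial>M)) \<longlonglongrightarrow> char M t"
    if M: "real_distribution M" "AE x in M. x \<in> {0..1}" for M
  proof -
    interpret real_distribution M by fact
    have AE: "AE x in M. norm (x ^ k) \<le> 1" for k
      using M(2) by (auto simp: power_abs power_le_one)
    have int: "integrable M (\<lambda>x. x ^ k)" for k
      using AE[of k] by (intro integrable_const_bound[where B=1]) auto
    \<comment> \<open>The Taylor remainder of the characteristic function is at most 2|t|^n / n!
      times the n-th absolute moment, and that moment is at most 1 on the unit interval.\<close>
    have "norm ((\<Sum>k\<le>n. ((\<i> * t)^k / fact k) * (\<integral>x. x ^ k \<partial>M)) - char M t) \<le> 2 * \<bar>t\<bar>^n / fact n" for n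
    proof -
      have "(\<integral>x. \<bar>x\<bar> ^ n \<partial>M) \<le> (\<integral>x. 1 \<partial>M)"
        using AE[of n] integrable_norm[OF int[of n]]
        by (intro integral_mono_AE) (auto simp: power_abs)
      then have "(\<integral>x. \<bar>x\<bar> ^ n \<partial>M) \<le> 1" by (simp add: prob_space del: space_eq_univ)
      then have "(2*\<bar>t\<bar>^n / fact n) * (\<integral>x. \<bar>x\<bar> ^ n \<partial>M) \<le> (2*\<bar>t\<bar>^n / fact n) * 1"
        by (intro mult_left_mono) auto
      with char_approx1[of n t, OF int] show ?thesis by (simp add: norm_minus_commute)
    qed
    moreover have "(\<lambda>n. 2 * \<bar>t\<bar>^n / fact n) \<longlonglongrightarrow> 0"
      using tendsto_mult[OF tendsto_const[of 2] summable_LIMSEQ_zero[OF summable_exp[of "\<bar>t\<bar>"]]]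
      by (simp add: divide_inverse mult_ac)
    ultimately have "(\<lambda>n. (\<Sum>k\<le>n. ((\<i> * t)^k / fact k) * (\<integral>x. x ^ k \<partial>M)) - char M t) \<longlonglongrightarrow> 0"
      by (rule Lim_null_comparison[OF always_eventually[OF allI]])
    then show ?thesis by (rule LIM_zero_cancel)
  qed
  show "char P t = char Q t"
    using conv[OF assms(1,3)] conv[OF assms(2,4)] by (intro LIMSEQ_unique) (simp_all add: eq)
qed

lemma nonneg_law_laplace_eqI:
  assumes P: "nonneg_law P" and Q: "nonneg_law Q"
    and eq: "\<And>\<mu>. 0 < \<mu> \<Longrightarrow> laplace P \<mu> = laplace Q \<mu>"
  shows "P = Q"
proof -
  interpret P: real_distribution P using P by (rule nonneg_law_real_distribution)
  interpret Q: real_distribution Q using Q by (rule nonneg_law_real_distribution)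
  let ?D = "\<lambda>M. distr M borel (\<lambda>x. exp (- x :: real))"
  have mom: "(\<integral>y. y ^ k \<partial>?D M) = laplace M (real k)" if "sets M = sets borel" for M k
    using that by (subst integral_distr)
      (auto simp: laplace_def exp_of_nat_mult[symmetric] cong: measurable_cong_sets)
  have "?D P = ?D Q"
  proof (rule real_distribution_unit_interval_eqI)
    show "AE x in ?D P. x \<in> {0..1}" "AE x in ?D Q. x \<in> {0..1}"
      using P Q by (auto simp: AE_distr_iff nonneg_law_def)
    fix k :: nat
    show "(\<integral>x. x ^ k \<partial>?D P) = (\<integral>x. x ^ k \<partial>?D Q)"
    \<comment> \<open>The hypothesis speaks of positive arguments only; the zeroth moment is the
      total mass 1 on both sides.\<close>
    proof (cases "k = 0")
      case True
      then show ?thesis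
        unfolding mom[OF P.events_eq_borel] mom[OF Q.events_eq_borel]
        using P.prob_space Q.prob_space by (simp add: laplace_def)
    qed (simp add: mom eq)
  qed auto
  then have "distr (?D P) borel (\<lambda>x. - ln x) = distr (?D Q) borel (\<lambda>x. - ln x)" by simp
  moreover have "distr (?D M) borel (\<lambda>x. - ln x) = M" if "sets M = sets borel" for M
  proof -
    have "distr (?D M) borel (\<lambda>x. - ln x) = distr M M (\<lambda>x. x)"
      using that by (subst distr_distr) (simp_all add: comp_def cong: measurable_cong_sets distr_cong)
    then show ?thesis by (simp add: distr_id)
  qed
  ultimately show ?thesis by (metis P.events_eq_borel Q.events_eq_borel)
qed

section \<open>Infinitely divisible laws with a given Levy measure\<close>

text \<open>A continuity theorem on the half-line. Condition \<open>near_1\<close> is equicontinuity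
  of the transforms at 0 and forces tightness; Helly selection then yields a weak limit along a
  subsequence, and one subsequence is enough to identify its transform because the whole sequence of
  transforms converges.\<close>

lemma nonneg_law_claplace_limit:
  fixes Q :: "nat \<Rightarrow> real measure"
  assumes law: "\<And>n. nonneg_law (Q n)"
    and near_1: "\<And>\<delta>. 0 < \<delta> \<Longrightarrow> \<exists>\<mu>>0. \<forall>n. 1 - laplace (Q n) \<mu> \<le> \<delta>"
    and lim: "\<And>w. 0 \<le> Re w \<Longrightarrow> (\<lambda>n. claplace (Q n) w) \<longlonglongrightarrow> \<Phi> w"
  shows "\<exists>P. nonneg_law P \<and> (\<forall>w. 0 \<le> Re w \<longrightarrow> claplace P w = \<Phi> w)"
proof -
  interpret Q: real_distribution "Q n" for n
    using law by (rule nonneg_law_real_distribution)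
  have AE_Q: "AE x in Q n. 0 \<le> x" for n using law by (simp add: nonneg_law_def)
  have "tight Q"
    unfolding tight_def
  proof (intro conjI allI impI)
    fix \<epsilon> :: real assume "0 < \<epsilon>"
    then obtain \<mu> where \<mu>: "0 < \<mu>" "\<And>n. 1 - laplace (Q n) \<mu> \<le> \<epsilon> / 4"
      using near_1[of "\<epsilon> / 4"] by auto
    \<comment> \<open>The left end -1 stands for any negative number, so that the half-open interval
      contains 0. To the right of \<open>1/\<mu>\<close> the integrand
      \<open>1 - exp (- \<mu> * x)\<close> is at least 1 - 1/e >= 1/2, hence a defect of at most
      \<open>\<epsilon> / 4\<close> leaves mass at most \<open>\<epsilon> / 2\<close>
      outside.\<close>
    have "1 - \<epsilon> < measure (Q n) {-1<..1/\<mu>}" for n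
    proof -
      have int: "integrable (Q n) (\<lambda>x. exp (- \<mu> * x))"
        using AE_Q[of n] \<mu>(1) by (intro Q.integrable_const_bound[where B=1]) auto
      have ind: "integrable (Q n) (indicator {-1<..1/\<mu>} :: real \<Rightarrow> real)"
        by (intro Q.integrable_const_bound[where B=1]) auto
      have exp_1: "exp (- 1 :: real) \<le> 1 / 2"
        using exp_ge_add_one_self[of 1] by (simp add: exp_minus field_simps)
      have "AE x in Q n. 1/2 * (1 - indicator {-1<..1/\<mu>} x) \<le> 1 - exp (- \<mu> * x)"
        using AE_Q[of n]
      proof eventually_elim
        case (elim x)
        show ?case
        proof (cases "x \<in> {-1<..1/\<mu>}")
          case False
          with elim \<mu> have "1 \<le> \<mu> * x" by (auto simp: field_simps)
          then have "exp (- \<mu> * x) \<le> exp (- 1)" by simp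
          with exp_1 have "1/2 \<le> 1 - exp (- \<mu> * x)" by linarith
          with False show ?thesis by simp
        qed (use elim \<mu> in auto)
      qed
      then have "(\<integral>x. 1/2 * (1 - indicator {-1<..1/\<mu>} x) \<partial>Q n) \<le> (\<integral>x. 1 - exp (- \<mu> * x) \<partial>Q n)"
        using int ind
        by (intro integral_mono_AE integrable_mult_right Bochner_Integration.integrable_diff) auto
      then have "1/2 * (1 - measure (Q n) {-1<..1/\<mu>}) \<le> 1 - laplace (Q n) \<mu>"
        using int ind Q.prob_space[of n] by (simp add: laplace_def)
      with \<mu>(2)[of n] \<open>0 < \<epsilon>\<close> show ?thesis by (simp add: field_simps)
    qed
    moreover have "-1 < 1/\<mu>" using \<mu>(1) by (meson less_trans neg_less_0_iff_less zero_less_divide_1_iff zero_less_one)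
    ultimately show "\<exists>a b. a < b \<and> (\<forall>n. 1 - \<epsilon> < measure (Q n) {a<..b})" by blast
  qed (rule Q.real_distribution_axioms)
  from tight_imp_convergent_subsubsequence[OF this strict_mono_id]
  obtain r P where r: "strict_mono r" and P: "real_distribution P"
    and weak: "weak_conv_m (Q \<circ> id \<circ> r) P" by blast
  interpret P: real_distribution P by fact
  have "\<And>n. real_distribution ((Q \<circ> id \<circ> r) n)" by (simp add: Q.real_distribution_axioms)
  note conv = weak_conv_imp_integral_bdd_continuous_conv[OF this P weak]
  \<comment> \<open>A bounded continuous function that vanishes exactly on the half-line: its
    integrals are all 0 and pass to the weak limit, which therefore has no mass below 0.\<close>
  let ?h = "\<lambda>x::real. min 1 (max 0 (- x))"
  have cont: "isCont ?h x" for x by (intro continuous_intros)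
  have "(\<lambda>n. integral\<^sup>L (Q (r n)) ?h) \<longlonglongrightarrow> integral\<^sup>L P ?h"
    using conv[of ?h 1] cont by (simp add: comp_def)
  moreover have "integral\<^sup>L (Q n) ?h = 0" for n
    using AE_Q[of n] by (intro integral_eq_zero_AE) auto
  ultimately have "integral\<^sup>L P ?h = 0" by (simp add: LIMSEQ_const_iff)
  moreover have "integrable P ?h" by (intro P.integrable_const_bound[where B=1]) auto
  ultimately have "AE x in P. ?h x = 0"
    by (subst (asm) integral_nonneg_eq_0_iff_AE) auto
  then have AE_P: "AE x in P. 0 \<le> x" by (auto simp: min_def max_def split: if_splits)
  then have law_P: "nonneg_law P" by (simp add: nonneg_law_def P.prob_space_axioms)
  have "claplace P w = \<Phi> w" if w: "0 \<le> Re w" for w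
  proof -
    \<comment> \<open>On the negative axis the exponential is unbounded when Re w > 0. Truncating
      with \<open>max 0\<close> gives a bounded continuous test function that agrees with it almost
      everywhere for every law on the half-line.\<close>
    let ?f = "\<lambda>x. exp (- (w * complex_of_real (max 0 x)))"
    have eq: "claplace M w = integral\<^sup>L M ?f" if "nonneg_law M" for M
      unfolding claplace_def
    proof (rule integral_cong_AE)
      show "AE x in M. exp (- (w * complex_of_real x)) = ?f x"
        using that by (auto simp: nonneg_law_def max_def)
    qed (use that in \<open>auto simp: nonneg_law_def cong: measurable_cong_sets\<close>)
    have cont: "isCont ?f x" for x by (intro continuous_intros)
    have "(\<lambda>n. integral\<^sup>L (Q (r n)) ?f) \<longlonglongrightarrow> integral\<^sup>L P ?f"
      using conv[of ?f 1] w cont by (simp add: comp_def mult_nonneg_nonneg)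
    then have "(\<lambda>n. claplace (Q (r n)) w) \<longlonglongrightarrow> claplace P w"
      by (simp add: eq law law_P)
    moreover have "(\<lambda>n. claplace (Q (r n)) w) \<longlonglongrightarrow> \<Phi> w"
      using LIMSEQ_subseq_LIMSEQ[OF lim[OF w] r] by (simp add: comp_def)
    ultimately show ?thesis by (rule LIMSEQ_unique)
  qed
  with law_P show ?thesis by blast
qed

text \<open>Mean value inequality on the left half-plane, which is convex and on which the
  derivative of exp has norm at most 1.\<close>

lemma norm_one_minus_exp_le:
  assumes "0 \<le> Re z"
  shows "norm (1 - exp (- z)) \<le> norm z"
proof -
  have "norm (exp (- z) - exp 0) \<le> 1 * norm (- z - 0)"
    using assms
    by (intro field_differentiable_bound[where S="{z. Re z \<le> 0}" and f'=exp])
       (auto simp: convex_halfspace_Re_le intro!: derivative_eq_intros)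
  then show ?thesis by (simp add: norm_minus_commute)
qed

text \<open>Mean value inequality for exp z - z on a half-disc of radius |z|, where the preceding
  estimate bounds the derivative exp u - 1 by |z|.\<close>

lemma norm_exp_minus_linear_le:
  assumes "0 \<le> Re z"
  shows "norm (1 - z - exp (- z)) \<le> norm z ^ 2"
proof -
  have "norm ((exp (- z) - (- z)) - (exp 0 - 0)) \<le> norm z * norm (- z - 0)"
  proof (rule field_differentiable_bound[where S="{z. Re z \<le> 0} \<inter> cball 0 (norm z)" and f'="\<lambda>z. exp z - 1" and f="\<lambda>z. exp z - z"])
    show "norm (exp u - 1) \<le> norm z" if "u \<in> {z. Re z \<le> 0} \<inter> cball 0 (norm z)" for u
      using norm_one_minus_exp_le[of "- u"] that by (auto simp: norm_minus_commute)
  qed (use assms in \<open>auto simp: convex_halfspace_Re_le intro!: derivative_eq_intros convex_Int\<close>)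
  moreover have "(exp (- z) - (- z)) - (exp 0 - 0) = - (1 - z - exp (- z))" by simp
  ultimately show ?thesis by (simp only: norm_minus_cancel) (simp add: power2_eq_square)
qed

text \<open>The weight \<open>min 1 x\<close> is the integrability condition for Levy measures of
  subordinators, so this is the majorant for dominated convergence in the exponents.\<close>

lemma norm_one_minus_exp_min:
  assumes "0 \<le> Re w" "0 \<le> x"
  shows "norm (1 - exp (- (w * complex_of_real x))) \<le> (2 + norm w) * min 1 x"
proof -
  have 1: "norm (1 - exp (- (w * complex_of_real x))) \<le> norm w * x"
    using norm_one_minus_exp_le[of "w * complex_of_real x"] assms by (simp add: norm_mult)
  have 2: "norm (1 - exp (- (w * complex_of_real x))) \<le> 2"
    using norm_triangle_ineq4[of 1 "exp (- (w * complex_of_real x))"] norm_exp_neg_le_1[OF assms]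
    by (simp del: norm_exp_eq_Re)
  show ?thesis
  proof (cases "x \<le> 1")
    case True
    then show ?thesis using 1 assms by (simp add: distrib_right)
  next
    case False
    then show ?thesis using 2 norm_ge_zero[of w] by (simp, linarith)
  qed
qed

text \<open>The atom at \<open>0\<close> is obtained by spreading its mass over \<open>[-1, 0]\<close> and collapsing that
  interval with \<open>max 0\<close>, so that the law stays the image of a density.\<close>

lemma compound_poisson_approx:
  fixes \<nu> :: "real measure" and g :: "real \<Rightarrow> ennreal"
  assumes [measurable]: "g \<in> borel_measurable borel" and \<nu>: "\<nu> = density lborel g"
    and d: "0 < d" and m: "0 < m" "emeasure \<nu> {d<..} \<le> ennreal m"
  shows "\<exists>F. nonneg_law F \<and> (\<forall>w. 0 \<le> Re w \<longrightarrow>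
    claplace F w = 1 - (\<integral>x. indicator {d<..} x *\<^sub>R (1 - exp (- (w * complex_of_real x))) \<partial>\<nu>) / of_real m)"
proof -
  define c where "c = measure \<nu> {d<..}"
  have sets_\<nu>[measurable_cong]: "sets \<nu> = sets borel" by (simp add: \<nu>)
  have c: "emeasure \<nu> {d<..} = ennreal c" "0 \<le> c"
    using emeasure_eq_ennreal_measure[of \<nu> "{d<..}"] neq_top_trans[OF ennreal_neq_top m(2)]
    by (auto simp: c_def)
  with m have "c \<le> m" by (simp add: ennreal_le_iff)
  define f where "f x = ennreal (1 / m) * (indicator {d<..} x * g x) + ennreal (1 - c / m) * indicator {-1..0} x" for x
  have [measurable]: "f \<in> borel_measurable borel" unfolding f_def by measurable
  define N where "N = density lborel f"
  have [measurable_cong]: "sets N = sets borel" by (simp add: N_def)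
  have "(\<integral>\<^sup>+x. f x \<partial>lborel) = ennreal (1 / m) * (\<integral>\<^sup>+x. indicator {d<..} x * g x \<partial>lborel) + ennreal (1 - c / m) * ennreal 1"
    unfolding f_def by (subst nn_integral_add; (subst nn_integral_cmult)?) (auto simp: nn_integral_cmult)
  also have "(\<integral>\<^sup>+x. indicator {d<..} x * g x \<partial>lborel) = ennreal c"
    unfolding c(1)[symmetric] \<nu> by (subst emeasure_density) (auto simp: mult.commute)
  also have "ennreal (1 / m) * ennreal c + ennreal (1 - c / m) * ennreal 1 = 1"
    using m \<open>c \<le> m\<close> c by (simp flip: ennreal_mult ennreal_plus)
  finally have "prob_space N"
    by (intro prob_spaceI) (simp add: N_def emeasure_density)
  then interpret N: prob_space N .
  define F where "F = distr N borel (\<lambda>x. max 0 x)"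
  have F: "nonneg_law F"
    unfolding nonneg_law_def F_def by (auto intro!: N.prob_space_distr simp: AE_distr_iff)
  \<comment> \<open>To the right of 0 the density of \<open>N\<close> is that of
    \<open>\<nu>\<close> cut at \<open>d\<close> and divided by \<open>m\<close>. The mass over
    [-1, 0] is collapsed to 0, where 1 - exp vanishes, so it does not contribute to the transform
    beyond the constant 1.\<close>
  have dens: "density N (indicator {0<..}) = density \<nu> (\<lambda>x. ennreal (1 / m * indicator {d<..} x))"
    unfolding N_def \<nu> using m d
    by (subst (1 2) density_density_eq)
       (auto simp: f_def mult.commute intro!: density_cong split: split_indicator)
  have "claplace F w = 1 - (\<integral>x. indicator {d<..} x *\<^sub>R (1 - exp (- (w * complex_of_real x))) \<partial>\<nu>) / of_real m"
    if w: "0 \<le> Re w" for w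
  proof -
    let ?h = "\<lambda>x. 1 - exp (- (w * complex_of_real (max 0 x)))"
    let ?k = "\<lambda>x. 1 - exp (- (w * complex_of_real x))"
    have "claplace F w = (\<integral>x. 1 - ?h x \<partial>N)"
      unfolding claplace_def F_def by (subst integral_distr) auto
    also have "\<dots> = 1 - (\<integral>x. ?h x \<partial>N)"
    proof (subst Bochner_Integration.integral_diff)
      have "integrable N (\<lambda>x. exp (- (w * complex_of_real (max 0 x))))"
        using w by (intro N.integrable_const_bound[where B=1]) (auto intro!: mult_nonneg_nonneg)
      then show "integrable N ?h" by simp
    qed (use N.prob_space in auto)
    also have "(\<integral>x. ?h x \<partial>N) = (\<integral>x. indicator {0<..} x *\<^sub>R ?h x \<partial>N)"
      by (intro Bochner_Integration.integral_cong) (auto split: split_indicator)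
    also have "\<dots> = (\<integral>x. ?h x \<partial>density N (\<lambda>x. ennreal (indicator {0<..} x)))"
      by (subst integral_density) auto
    also have "\<dots> = (\<integral>x. (1 / m * indicator {d<..} x) *\<^sub>R ?h x \<partial>\<nu>)"
      using m by (simp add: ennreal_indicator dens) (subst integral_density, auto)
    also have "\<dots> = (\<integral>x. (indicator {d<..} x *\<^sub>R ?k x) / of_real m \<partial>\<nu>)"
      using d by (intro Bochner_Integration.integral_cong) (auto simp: scaleR_conv_of_real split: split_indicator)
    finally show ?thesis by simp
  qed
  with F show ?thesis by blast
qed

text \<open>For a and b in the unit disc |a^m - b^m| <= m |a - b|. With a = 1 - z, b = exp (- z) and
  z = \<open>\<psi> n / m n\<close> the second-order estimate bounds the difference by
  |\<open>\<psi> n\<close>|^2 / \<open>m n\<close>, and the numerator is bounded because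
  \<open>\<psi>\<close> converges.\<close>

lemma power_tendsto_exp_neg:
  fixes \<psi> :: "nat \<Rightarrow> complex" and m :: "nat \<Rightarrow> nat"
  assumes lim: "\<psi> \<longlonglongrightarrow> l" and m: "filterlim m at_top sequentially" "\<And>n. 0 < m n"
    and Re: "\<And>n. 0 \<le> Re (\<psi> n)" and bound: "\<And>n. norm (1 - \<psi> n / of_nat (m n)) \<le> 1"
  shows "(\<lambda>n. (1 - \<psi> n / of_nat (m n)) ^ m n) \<longlonglongrightarrow> exp (- l)"
proof -
  have inv: "(\<lambda>n. 1 / real (m n)) \<longlonglongrightarrow> 0"
    using tendsto_divide_0[OF tendsto_const filterlim_at_top_imp_at_infinity[OF filterlim_compose[OF filterlim_real_sequentially m(1)]]]
    by simp
  have "norm ((1 - \<psi> n / of_nat (m n)) ^ m n - exp (- \<psi> n)) \<le> norm (\<psi> n) ^ 2 * (1 / real (m n))" for n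
  proof -
    let ?z = "\<psi> n / of_nat (m n)"
    have Re_z: "0 \<le> Re ?z" using Re[of n] by (simp add: Re_divide_of_nat)
    have "exp (- \<psi> n) = exp (- ?z) ^ m n"
      using m(2)[of n] by (simp flip: exp_of_nat_mult)
    then have "norm ((1 - ?z) ^ m n - exp (- \<psi> n)) \<le> real (m n) * norm (1 - ?z - exp (- ?z))"
      using bound[of n] norm_exp_neg_le_1[OF Re_z, of 1] by (simp only:) (intro norm_power_diff, auto)
    also have "\<dots> \<le> real (m n) * norm ?z ^ 2"
      by (intro mult_left_mono norm_exp_minus_linear_le Re_z) auto
    also have "\<dots> = norm (\<psi> n) ^ 2 * (1 / real (m n))"
      using m(2)[of n] by (simp add: norm_divide power2_eq_square field_simps)
    finally show ?thesis .
  qed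
  moreover have "(\<lambda>n. norm (\<psi> n) ^ 2 * (1 / real (m n))) \<longlonglongrightarrow> norm l ^ 2 * 0"
    by (intro tendsto_intros lim inv)
  ultimately have "(\<lambda>n. (1 - \<psi> n / of_nat (m n)) ^ m n - exp (- \<psi> n)) \<longlonglongrightarrow> 0"
    using Lim_null_comparison[OF always_eventually[OF allI],
        of "\<lambda>n. (1 - \<psi> n / of_nat (m n)) ^ m n - exp (- \<psi> n)" "\<lambda>n. norm (\<psi> n) ^ 2 * (1 / real (m n))"]
    by simp
  moreover have "(\<lambda>n. exp (- \<psi> n)) \<longlonglongrightarrow> exp (- l)" by (intro tendsto_intros lim)
  ultimately have "(\<lambda>n. (1 - \<psi> n / of_nat (m n)) ^ m n - exp (- \<psi> n) + exp (- \<psi> n)) \<longlonglongrightarrow> 0 + exp (- l)"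
    by (rule tendsto_add)
  then show ?thesis by simp
qed

text \<open>Jumps below \<open>d n\<close> are cut off. \<open>F n\<close> is the law of one rare
  jump, and the sum of \<open>m n\<close> independent copies has transform (1 -
  \<open>\<psi> n w / m n\<close>)^(\<open>m n\<close>), which tends to the exponential of minus the
  full exponent.\<close>

lemma levy_khintchine_law_exists:
  fixes \<nu> :: "real measure" and g :: "real \<Rightarrow> ennreal"
  assumes [measurable]: "g \<in> borel_measurable borel" and \<nu>: "\<nu> = density lborel g"
    and AE_pos: "AE x in \<nu>. 0 < x" and int_min: "integrable \<nu> (\<lambda>x. min 1 x)"
  shows "\<exists>P. nonneg_law P \<and> (\<forall>w. 0 \<le> Re w \<longrightarrow>
    claplace P w = exp (- (\<integral>x. 1 - exp (- (w * complex_of_real x)) \<partial>\<nu>)))"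
proof -
  have sets_\<nu>[measurable_cong]: "sets \<nu> = sets borel" by (simp add: \<nu>)
  define d where "d n = 1 / real (Suc n)" for n
  have d_pos: "0 < d n" and d_le: "d n \<le> 1" for n by (auto simp: d_def)
  have d_lim: "d \<longlonglongrightarrow> 0" unfolding d_def by (rule LIMSEQ_Suc[OF lim_1_over_n])
  have fin: "emeasure \<nu> {d n<..} < \<infinity>" for n
  proof -
    have "integrable \<nu> (indicator {d n<..} :: real \<Rightarrow> real)"
    proof (rule Bochner_Integration.integrable_bound)
      show "integrable \<nu> (\<lambda>x. 1 / d n * min 1 x)" using int_min by simp
      show "AE x in \<nu>. norm (indicator {d n<..} x :: real) \<le> norm (1 / d n * min 1 x)"
        using AE_pos d_pos[of n] d_le[of n] by (auto simp: field_simps min_def split: split_indicator)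
    qed simp
    then show ?thesis by (simp add: integrable_indicator_iff)
  qed
  \<comment> \<open>Rounding up the mass of jumps above \<open>d n\<close> makes room for
    \<open>F n\<close> to be a probability law; \<open>Suc n\<close> forces \<open>m n\<close> to
    infinity even if \<open>\<nu>\<close> is finite.\<close>
  define m where "m n = nat \<lceil>measure \<nu> {d n<..}\<rceil> + Suc n" for n
  have m_pos: "0 < m n" for n by (simp add: m_def)
  have m_ge: "emeasure \<nu> {d n<..} \<le> ennreal (real (m n))" for n
  proof -
    have "measure \<nu> {d n<..} \<le> real (m n)" unfolding m_def by simp linarith
    then show ?thesis using fin[of n] by (simp add: emeasure_eq_ennreal_measure ennreal_leI)
  qed
  have m_lim: "filterlim m at_top sequentially"
    by (rule filterlim_at_top_mono[OF filterlim_Suc]) (simp add: m_def)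
  define \<psi> where "\<psi> n w = (\<integral>x. indicator {d n<..} x *\<^sub>R (1 - exp (- (w * complex_of_real x))) \<partial>\<nu>)" for n w
  define \<Psi> where "\<Psi> w = (\<integral>x. 1 - exp (- (w * complex_of_real x)) \<partial>\<nu>)" for w
  have "\<forall>n. \<exists>F. nonneg_law F \<and> (\<forall>w. 0 \<le> Re w \<longrightarrow> claplace F w = 1 - \<psi> n w / of_real (real (m n)))"
    unfolding \<psi>_def using d_pos m_pos m_ge by (intro allI compound_poisson_approx[OF assms(1) \<nu>]) auto
  then obtain F where F: "\<And>n. nonneg_law (F n)"
    and claplace_F: "\<And>n w. 0 \<le> Re w \<Longrightarrow> claplace (F n) w = 1 - \<psi> n w / of_nat (m n)" by auto metis
  have bound: "AE x in \<nu>. norm (1 - exp (- (w * complex_of_real x))) \<le> (2 + norm w) * min 1 x"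
    if "0 \<le> Re w" for w
    using AE_pos by eventually_elim (use norm_one_minus_exp_min[OF that] in auto)
  have int_\<Psi>: "integrable \<nu> (\<lambda>x. 1 - exp (- (w * complex_of_real x)))" if "0 \<le> Re w" for w
  proof (rule Bochner_Integration.integrable_bound)
    show "integrable \<nu> (\<lambda>x. (2 + norm w) * min 1 x)" using int_min by simp
    show "AE x in \<nu>. norm (1 - exp (- (w * complex_of_real x))) \<le> norm ((2 + norm w) * min 1 x)"
      using bound[OF that] AE_pos by eventually_elim (auto simp: abs_mult)
  qed simp
  have \<psi>_lim: "(\<lambda>n. \<psi> n w) \<longlonglongrightarrow> \<Psi> w" if "0 \<le> Re w" for w
    unfolding \<psi>_def \<Psi>_def
  proof (rule integral_dominated_convergence)
    show "integrable \<nu> (\<lambda>x. (2 + norm w) * min 1 x)" using int_min by simp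
    show "AE x in \<nu>. norm (indicator {d n<..} x *\<^sub>R (1 - exp (- (w * complex_of_real x)))) \<le> (2 + norm w) * min 1 x" for n
      using bound[OF that] AE_pos by eventually_elim (auto split: split_indicator)
    show "AE x in \<nu>. (\<lambda>n. indicator {d n<..} x *\<^sub>R (1 - exp (- (w * complex_of_real x)))) \<longlonglongrightarrow> 1 - exp (- (w * complex_of_real x))"
      using AE_pos
    proof eventually_elim
      case (elim x)
      then have "\<forall>\<^sub>F n in sequentially. d n < x" using d_lim by (intro order_tendstoD(2))
      then show ?case by (intro tendsto_eventually) (auto elim: eventually_mono)
    qed
  qed measurable
  \<comment> \<open>Read off from the bound 1 on the transform of \<open>F n\<close> instead of from
    the integral defining \<open>\<psi>\<close>.\<close>
  have \<psi>_Re: "0 \<le> Re (\<psi> n w)" if "0 \<le> Re w" for n w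
  proof -
    have "norm (1 - \<psi> n w / of_nat (m n)) \<le> 1"
      using norm_claplace_le_1[OF F that] claplace_F[OF that] by simp
    then have "Re (1 - \<psi> n w / of_nat (m n)) \<le> 1" using complex_Re_le_cmod order_trans by blast
    then show ?thesis using m_pos[of n] by (simp add: Re_divide_of_nat field_simps)
  qed
  define Q where "Q n = convpow (F n) (m n)" for n
  have Q: "nonneg_law (Q n)" for n unfolding Q_def by (intro nonneg_law_convpow F)
  have "(\<lambda>n. claplace (Q n) w) \<longlonglongrightarrow> exp (- \<Psi> w)" if w: "0 \<le> Re w" for w
  proof -
    have "(\<lambda>n. (1 - \<psi> n w / of_nat (m n)) ^ m n) \<longlonglongrightarrow> exp (- \<Psi> w)"
      using norm_claplace_le_1[OF F w] claplace_F[OF w] \<psi>_Re[OF w]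
      by (intro power_tendsto_exp_neg \<psi>_lim[OF w] m_lim m_pos) auto
    then show ?thesis using w by (simp add: Q_def claplace_convpow F claplace_F)
  qed
  \<comment> \<open>Uniformity in n: Bernoulli's inequality bounds 1 minus the transform of
    \<open>Q n\<close> by the truncated exponent, which is at most the full exponent
    \<open>J \<mu>\<close>. The latter no longer depends on n and tends to 0 with
    \<open>\<mu>\<close>.\<close>
  moreover have "\<exists>\<mu>>0. \<forall>n. 1 - laplace (Q n) \<mu> \<le> \<delta>" if \<delta>: "0 < \<delta>" for \<delta>
  proof -
    define J where "J \<mu> = (\<integral>x. 1 - exp (- (\<mu> * x)) \<partial>\<nu>)" for \<mu>
    have \<psi>_real: "\<psi> n (of_real \<mu>) = of_real (\<integral>x. indicator {d n<..} x * (1 - exp (- (\<mu> * x))) \<partial>\<nu>)" for n \<mu>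
      unfolding \<psi>_def integral_complex_of_real[symmetric]
      by (intro Bochner_Integration.integral_cong) (auto simp: scaleR_conv_of_real simp flip: exp_of_real split: split_indicator)
    have int_J: "integrable \<nu> (\<lambda>x. 1 - exp (- (\<mu> * x)))" if "0 < \<mu>" for \<mu>
    proof -
      have "integrable \<nu> (\<lambda>x. Re (1 - exp (- (complex_of_real \<mu> * complex_of_real x))))"
        using int_\<Psi>[of "of_real \<mu>"] that by (intro integrable_Re) auto
      then show ?thesis by (simp add: Re_exp)
    qed
    have le_J: "1 - laplace (Q n) \<mu> \<le> J \<mu>" if \<mu>: "0 < \<mu>" for n \<mu>
    proof -
      define j where "j = (\<integral>x. indicator {d n<..} x * (1 - exp (- (\<mu> * x))) \<partial>\<nu>)"
      have "complex_of_real (laplace (Q n) \<mu>) = of_real ((1 - j / real (m n)) ^ m n)"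
        using \<mu> by (simp add: of_real_laplace Q_def claplace_convpow F claplace_F \<psi>_real j_def)
      then have lap: "laplace (Q n) \<mu> = (1 - j / real (m n)) ^ m n" by (simp only: of_real_eq_iff)
      \<comment> \<open>Bernoulli's inequality requires \<open>j / m n\<close> to be at most 1,
        which is the nonnegativity of the transform of the single factor \<open>F n\<close>.\<close>
      have "complex_of_real (laplace (F n) \<mu>) = of_real (1 - j / real (m n))"
        using \<mu> by (simp add: of_real_laplace claplace_F \<psi>_real j_def)
      then have "laplace (F n) \<mu> = 1 - j / real (m n)" by (simp only: of_real_eq_iff)
      moreover have "0 \<le> laplace (F n) \<mu>" by (simp add: laplace_def)
      ultimately have "- 1 \<le> - (j / real (m n))" by simp
      from Bernoulli_inequality[OF this, of "m n"]
      have "1 - j \<le> laplace (Q n) \<mu>" unfolding lap using m_pos[of n] by (simp add: field_simps)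
      moreover have "j \<le> J \<mu>"
        unfolding j_def J_def
      proof (rule integral_mono_AE)
        show "integrable \<nu> (\<lambda>x. indicator {d n<..} x * (1 - exp (- (\<mu> * x))))"
          using integrable_mult_indicator[OF _ int_J[OF \<mu>], of "{d n<..}"] by simp
        show "AE x in \<nu>. indicator {d n<..} x * (1 - exp (- (\<mu> * x))) \<le> 1 - exp (- (\<mu> * x))"
          using AE_pos \<mu> by (auto split: split_indicator)
      qed (rule int_J[OF \<mu>])
      ultimately show ?thesis by simp
    qed
    have "(\<lambda>k. J (d k)) \<longlonglongrightarrow> (\<integral>x. 0 \<partial>\<nu>)"
      unfolding J_def
    proof (rule integral_dominated_convergence)
      show "integrable \<nu> (\<lambda>x. 1 - exp (- (1 * x)))" by (rule int_J) simp
      show "AE x in \<nu>. norm (1 - exp (- (d k * x))) \<le> 1 - exp (- (1 * x))" for k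
        using AE_pos by eventually_elim (use d_pos[of k] d_le[of k] in \<open>auto simp: mult_le_cancel_right1\<close>)
      have "(\<lambda>k. 1 - exp (- (d k * x))) \<longlonglongrightarrow> 1 - exp (- (0 * x))" for x
        by (intro tendsto_intros d_lim)
      then show "AE x in \<nu>. (\<lambda>k. 1 - exp (- (d k * x))) \<longlonglongrightarrow> 0" by simp
    qed measurable
    then have "\<forall>\<^sub>F k in sequentially. J (d k) < \<delta>" using \<delta> by (intro order_tendstoD(2)) auto
    then obtain k where "J (d k) < \<delta>" by (auto simp: eventually_sequentially)
    then show ?thesis using d_pos[of k] le_J[of "d k"] by (meson less_eq_real_def order_trans)
  qed
  ultimately show ?thesis
    using nonneg_law_claplace_limit[of Q "\<lambda>w. exp (- \<Psi> w)"] Q unfolding \<Psi>_def by blast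
qed

section \<open>Moments and normal approximation\<close>

text \<open>Squeezed by a <= exp a - 1 <= a exp a, valid for either sign of a; no division by
  \<open>a n\<close>, which may be 0, occurs.\<close>

lemma exp_minus_1_over_tendsto:
  fixes a d :: "nat \<Rightarrow> real"
  assumes "a \<longlonglongrightarrow> 0" "(\<lambda>n. a n / d n) \<longlonglongrightarrow> l" "\<And>n. 0 < d n"
  shows "(\<lambda>n. (exp (a n) - 1) / d n) \<longlonglongrightarrow> l"
proof (rule real_tendsto_sandwich)
  show "\<forall>\<^sub>F n in sequentially. a n / d n \<le> (exp (a n) - 1) / d n"
    using assms(3) exp_ge_add_one_self by (intro always_eventually allI divide_right_mono) (auto simp: le_diff_eq add.commute less_imp_le)
  have *: "exp x - 1 \<le> x * exp x" for x :: real
    using exp_ge_add_one_self[of "- x"] by (simp add: exp_minus field_simps)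
  have "(exp (a n) - 1) / d n \<le> a n / d n * exp (a n)" for n
    using divide_right_mono[OF *[of "a n"], of "d n"] assms(3)[of n] by simp
  then show "\<forall>\<^sub>F n in sequentially. (exp (a n) - 1) / d n \<le> a n / d n * exp (a n)" by simp
  show "(\<lambda>n. a n / d n * exp (a n)) \<longlonglongrightarrow> l"
    using tendsto_mult[OF assms(2) tendsto_exp[OF assms(1)]] by simp
qed fact

text \<open>Integrability of the limit is part of the conclusion: Fatou bounds its integral by
  \<open>m\<close>, and then the limit itself is the majorant for dominated convergence. This is how
  moments of a law are obtained from its Laplace transform before they are known to exist.\<close>

lemma integral_eq_lim_dominated_by_limit:
  fixes f :: "nat \<Rightarrow> 'a \<Rightarrow> real" and F :: "'a \<Rightarrow> real"
  assumes [measurable]: "F \<in> borel_measurable M" and int: "\<And>n. integrable M (f n)"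
    and bound: "\<And>n. AE x in M. 0 \<le> f n x \<and> f n x \<le> F x"
    and lim: "AE x in M. (\<lambda>n. f n x) \<longlonglongrightarrow> F x"
    and m: "(\<lambda>n. integral\<^sup>L M (f n)) \<longlonglongrightarrow> m"
  shows "integrable M F" "integral\<^sup>L M F = m"
proof -
  have [measurable]: "f n \<in> borel_measurable M" for n using int by auto
  have "(\<integral>\<^sup>+x. ennreal (F x) \<partial>M) = (\<integral>\<^sup>+x. liminf (\<lambda>n. ennreal (f n x)) \<partial>M)"
  proof (rule nn_integral_cong_AE, use lim in eventually_elim)
    case (elim x)
    then have "(\<lambda>n. ennreal (f n x)) \<longlonglongrightarrow> ennreal (F x)" by (rule tendsto_ennrealI)
    then show ?case by (simp add: lim_imp_Liminf)
  qed
  also have "\<dots> \<le> liminf (\<lambda>n. \<integral>\<^sup>+x. ennreal (f n x) \<partial>M)" by (rule nn_integral_liminf) simp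
  also have "(\<lambda>n. \<integral>\<^sup>+x. ennreal (f n x) \<partial>M) = (\<lambda>n. ennreal (integral\<^sup>L M (f n)))"
    using bound int by (intro ext nn_integral_eq_integral) auto
  also have "liminf \<dots> = ennreal m" using m by (intro lim_imp_Liminf tendsto_ennrealI) auto
  finally have "(\<integral>\<^sup>+x. ennreal (F x) \<partial>M) < \<infinity>" by (auto simp: top_unique less_top[symmetric])
  moreover have "AE x in M. 0 \<le> F x" using bound[of 0] by eventually_elim linarith
  ultimately show F: "integrable M F" by (intro integrableI_nonneg) auto
  have "(\<lambda>n. integral\<^sup>L M (f n)) \<longlonglongrightarrow> integral\<^sup>L M F"
  proof (rule integral_dominated_convergence[OF _ _ F lim])
    show "AE x in M. norm (f n x) \<le> F x" for n using bound[of n] by eventually_elim auto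
  qed auto
  with m show "integral\<^sup>L M F = m" by (rule LIMSEQ_unique[rotated])
qed

lemma difference_quotient_exp:
  fixes x :: real
  assumes "0 < d" "0 \<le> x"
  shows "0 \<le> (1 - exp (- (d * x))) / d" "(1 - exp (- (d * x))) / d \<le> x"
  using assms exp_ge_add_one_self[of "- (d * x)"] by (auto simp: field_simps)

lemma difference_quotient_exp_tendsto:
  fixes x :: real and d :: "nat \<Rightarrow> real"
  assumes "d \<longlonglongrightarrow> 0" "\<And>n. 0 < d n"
  shows "(\<lambda>n. (1 - exp (- (d n * x))) / d n) \<longlonglongrightarrow> x"
proof -
  have "(\<lambda>n. (exp (- (d n * x)) - 1) / d n) \<longlonglongrightarrow> - x"
  proof (rule exp_minus_1_over_tendsto)
    show "(\<lambda>n. - (d n * x)) \<longlonglongrightarrow> 0"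
      using tendsto_minus[OF tendsto_mult_left_zero[OF assms(1), of x]] by simp
    have "(\<lambda>n. - (d n * x) / d n) = (\<lambda>n. - x)"
      using assms(2) by (auto simp: fun_eq_iff less_imp_neq[symmetric])
    then show "(\<lambda>n. - (d n * x) / d n) \<longlonglongrightarrow> - x" by simp
  qed fact
  from tendsto_minus[OF this] show ?thesis by (simp add: minus_divide_left)
qed

text \<open>With \<open>\<phi> = exp (- \<psi>)\<close> the second difference \<open>1 - 2 \<phi> \<mu> + \<phi> (2 \<mu>)\<close> splits as
  \<open>(1 - \<phi> \<mu>)\<^sup>2 + (\<phi> \<mu>)\<^sup>2 (exp h - 1)\<close> with \<open>h = 2 \<psi> \<mu> - \<psi> (2 \<mu>)\<close>, and \<open>h\<close> is the integral of
  \<open>(1 - exp (- \<mu> x))\<^sup>2\<close> against the Levy measure.\<close>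

lemma levy_khintchine_moments:
  assumes P: "nonneg_law P" and [measurable_cong]: "sets \<nu> = sets borel"
    and laplace: "\<And>\<mu>. 0 < \<mu> \<Longrightarrow> laplace P \<mu> = exp (- (\<integral>x. 1 - exp (- (\<mu> * x)) \<partial>\<nu>))"
    and AE_pos: "AE x in \<nu>. 0 < x" and int1: "integrable \<nu> (\<lambda>x. x)" and int2: "integrable \<nu> (\<lambda>x. x\<^sup>2)"
  shows "integrable P (\<lambda>x. x)" "(\<integral>x. x \<partial>P) = (\<integral>x. x \<partial>\<nu>)"
    "integrable P (\<lambda>x. x\<^sup>2)" "(\<integral>x. x\<^sup>2 \<partial>P) = (\<integral>x. x \<partial>\<nu>)\<^sup>2 + (\<integral>x. x\<^sup>2 \<partial>\<nu>)"
proof -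
  interpret P: real_distribution P using P by (rule nonneg_law_real_distribution)
  have AE_P: "AE x in P. 0 \<le> x" using P by (simp add: nonneg_law_def)
  define d where "d n = 1 / real (Suc n)" for n
  have d_pos: "0 < d n" for n by (auto simp: d_def)
  have d_lim: "d \<longlonglongrightarrow> 0" unfolding d_def by (rule LIMSEQ_Suc[OF lim_1_over_n])
  \<comment> \<open>The difference quotient approximates x from below, and its integral under
    \<open>P\<close> is an expression in the Laplace transform of \<open>P\<close>.\<close>
  define q where "q n x = (1 - exp (- (d n * x))) / d n" for n and x :: real
  have [measurable]: "q n \<in> borel_measurable borel" for n unfolding q_def by measurable
  have q: "0 \<le> q n x" "q n x \<le> x" if "0 \<le> x" for n x
    unfolding q_def using difference_quotient_exp[OF d_pos that] by auto
  have q_sq: "(q n x)\<^sup>2 \<le> x\<^sup>2" if "0 \<le> x" for n x using q[OF that] by (intro power_mono)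
  have q_lim: "(\<lambda>n. q n x) \<longlonglongrightarrow> x" for x
    unfolding q_def using d_lim d_pos by (rule difference_quotient_exp_tendsto)
  define \<psi> where "\<psi> \<mu> = (\<integral>x. 1 - exp (- (\<mu> * x)) \<partial>\<nu>)" for \<mu>
  have int_\<psi>: "integrable \<nu> (\<lambda>x. 1 - exp (- (\<mu> * x)))" if "0 < \<mu>" for \<mu>
  proof (rule Bochner_Integration.integrable_bound)
    show "integrable \<nu> (\<lambda>x. \<mu> * x)" using int1 by simp
    show "AE x in \<nu>. norm (1 - exp (- (\<mu> * x))) \<le> norm (\<mu> * x)"
      using AE_pos
    proof eventually_elim
      case (elim x)
      then show ?case
        using that difference_quotient_exp[of \<mu> x] by (simp add: field_simps)
    qed
  qed simp
  have q1: "(\<lambda>n. \<integral>x. q n x \<partial>\<nu>) \<longlonglongrightarrow> (\<integral>x. x \<partial>\<nu>)"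
  proof (rule integral_dominated_convergence[OF _ _ int1])
    show "AE x in \<nu>. norm (q n x) \<le> x" for n
      using AE_pos by eventually_elim (use q in auto)
  qed (auto intro: q_lim)
  have q2: "(\<lambda>n. \<integral>x. (q n x)\<^sup>2 \<partial>\<nu>) \<longlonglongrightarrow> (\<integral>x. x\<^sup>2 \<partial>\<nu>)"
  proof (rule integral_dominated_convergence[OF _ _ int2])
    show "AE x in \<nu>. norm ((q n x)\<^sup>2) \<le> x\<^sup>2" for n
      using AE_pos by eventually_elim (use q_sq in auto)
  qed (auto intro!: q_lim tendsto_power)
  have \<psi>_q: "\<psi> (d n) / d n = (\<integral>x. q n x \<partial>\<nu>)" for n
    unfolding q_def \<psi>_def by simp
  have \<psi>_d: "(\<lambda>n. \<psi> (d n)) \<longlonglongrightarrow> 0"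
  proof -
    have "(\<lambda>n. \<psi> (d n) / d n * d n) \<longlonglongrightarrow> (\<integral>x. x \<partial>\<nu>) * 0"
      unfolding \<psi>_q by (intro tendsto_mult q1 d_lim)
    then show ?thesis using d_pos by (simp add: less_imp_neq[symmetric])
  qed
  define h where "h n = 2 * \<psi> (d n) - \<psi> (2 * d n)" for n
  have h_q: "h n / (d n)\<^sup>2 = (\<integral>x. (q n x)\<^sup>2 \<partial>\<nu>)" for n
  proof -
    have "h n = (\<integral>x. 2 * (1 - exp (- (d n * x))) - (1 - exp (- (2 * d n * x))) \<partial>\<nu>)"
      unfolding h_def \<psi>_def using int_\<psi>[of "d n"] int_\<psi>[of "2 * d n"] d_pos[of n]
      by (simp only: Bochner_Integration.integral_diff integrable_mult_right integral_mult_right_zero mult_pos_pos zero_less_numeral)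
    also have "\<dots> = (\<integral>x. (d n)\<^sup>2 * (q n x)\<^sup>2 \<partial>\<nu>)"
    proof (intro Bochner_Integration.integral_cong refl)
      fix x
      have "exp (- (2 * d n * x)) = exp (- (d n * x)) ^ 2" by (simp flip: exp_double)
      moreover have "(d n)\<^sup>2 * (q n x)\<^sup>2 = (1 - exp (- (d n * x)))\<^sup>2"
        using d_pos[of n] by (simp add: q_def power_divide)
      ultimately show "2 * (1 - exp (- (d n * x))) - (1 - exp (- (2 * d n * x))) = (d n)\<^sup>2 * (q n x)\<^sup>2"
        by (simp add: power2_diff)
    qed
    finally show ?thesis using d_pos[of n] by simp
  qed
  have h_lim: "h \<longlonglongrightarrow> 0"
  proof -
    have "(\<lambda>n. h n / (d n)\<^sup>2 * (d n)\<^sup>2) \<longlonglongrightarrow> (\<integral>x. x\<^sup>2 \<partial>\<nu>) * 0\<^sup>2"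
      unfolding h_q by (intro tendsto_mult tendsto_power q2 d_lim)
    then show ?thesis using d_pos by (simp add: less_imp_neq[symmetric])
  qed
  have int_P: "integrable P (\<lambda>x. exp (- (\<mu> * x)))" if "0 < \<mu>" for \<mu>
    using AE_P that by (intro P.integrable_const_bound[where B=1]) auto
  have \<phi>: "(\<integral>x. exp (- (\<mu> * x)) \<partial>P) = exp (- \<psi> \<mu>)" if "0 < \<mu>" for \<mu>
    using laplace[OF that] by (simp add: laplace_def \<psi>_def)
  have int_qP: "integrable P (q n)" for n unfolding q_def using int_P[OF d_pos] by simp
  have q_sq_eq: "(q n x)\<^sup>2 = (1 - 2 * exp (- (d n * x)) + exp (- (2 * d n * x))) / (d n)\<^sup>2" for n x
  proof -
    have "exp (- (2 * d n * x)) = exp (- (d n * x)) ^ 2" by (simp flip: exp_double)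
    then show ?thesis by (simp add: q_def power_divide power2_eq_square algebra_simps)
  qed
  have int_q2P: "integrable P (\<lambda>x. (q n x)\<^sup>2)" for n
    unfolding q_sq_eq using int_P[OF d_pos[of n]] int_P[of "2 * d n"] d_pos[of n] by simp
  have qP: "(\<integral>x. q n x \<partial>P) = (1 - exp (- \<psi> (d n))) / d n" for n
    unfolding q_def using int_P[OF d_pos[of n]] \<phi>[OF d_pos[of n]] P.prob_space by simp
  have qP_lim: "(\<lambda>n. \<integral>x. q n x \<partial>P) \<longlonglongrightarrow> (\<integral>x. x \<partial>\<nu>)"
  proof -
    have "(\<lambda>n. (exp (- \<psi> (d n)) - 1) / d n) \<longlonglongrightarrow> - (\<integral>x. x \<partial>\<nu>)"
      using tendsto_minus[OF \<psi>_d] tendsto_minus[OF q1] d_pos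
      by (intro exp_minus_1_over_tendsto) (auto simp flip: \<psi>_q)
    from tendsto_minus[OF this] show ?thesis by (simp add: qP minus_divide_left)
  qed
  have q2P: "(\<integral>x. (q n x)\<^sup>2 \<partial>P) = (\<integral>x. q n x \<partial>P)\<^sup>2 + exp (- \<psi> (d n)) ^ 2 * ((exp (h n) - 1) / (d n)\<^sup>2)" for n
  proof -
    have "(\<integral>x. (q n x)\<^sup>2 \<partial>P) = (1 - 2 * exp (- \<psi> (d n)) + exp (- \<psi> (2 * d n))) / (d n)\<^sup>2"
      unfolding q_sq_eq
      using int_P[OF d_pos[of n]] int_P[of "2 * d n"] \<phi>[OF d_pos[of n]] \<phi>[of "2 * d n"] d_pos[of n] P.prob_space
      by simp
    also have "exp (- \<psi> (2 * d n)) = exp (- \<psi> (d n)) ^ 2 * exp (h n)"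
      by (simp add: h_def exp_diff exp_minus exp_double[symmetric] field_simps)
    also have "(1 - 2 * exp (- \<psi> (d n)) + exp (- \<psi> (d n)) ^ 2 * exp (h n)) / (d n)\<^sup>2 =
        ((1 - exp (- \<psi> (d n))) / d n)\<^sup>2 + exp (- \<psi> (d n)) ^ 2 * ((exp (h n) - 1) / (d n)\<^sup>2)"
      unfolding power_divide times_divide_eq_right add_divide_distrib[symmetric]
      by (intro arg_cong2[where f="(/)"]) (simp_all add: power2_diff algebra_simps)
    finally show ?thesis unfolding qP .
  qed
  have q2P_lim: "(\<lambda>n. \<integral>x. (q n x)\<^sup>2 \<partial>P) \<longlonglongrightarrow> (\<integral>x. x \<partial>\<nu>)\<^sup>2 + exp (- 0) ^ 2 * (\<integral>x. x\<^sup>2 \<partial>\<nu>)"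
    unfolding q2P
    by (intro tendsto_intros qP_lim \<psi>_d exp_minus_1_over_tendsto h_lim)
       (use d_pos q2 in \<open>simp_all add: h_q less_imp_neq[symmetric]\<close>)
  have bd1: "AE x in P. 0 \<le> q n x \<and> q n x \<le> x" for n using AE_P by eventually_elim (use q in auto)
  have bd2: "AE x in P. 0 \<le> (q n x)\<^sup>2 \<and> (q n x)\<^sup>2 \<le> x\<^sup>2" for n using AE_P by eventually_elim (use q_sq in auto)
  show "integrable P (\<lambda>x. x)" "(\<integral>x. x \<partial>P) = (\<integral>x. x \<partial>\<nu>)"
    by (rule integral_eq_lim_dominated_by_limit[OF _ int_qP bd1 _ qP_lim]; use q_lim in simp)+
  have q2_lim: "(\<lambda>n. (q n x)\<^sup>2) \<longlonglongrightarrow> x\<^sup>2" for x by (intro tendsto_power q_lim)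
  show "integrable P (\<lambda>x. x\<^sup>2)"
    using integral_eq_lim_dominated_by_limit(1)[OF _ int_q2P bd2 _ q2P_lim] q2_lim by simp
  show "(\<integral>x. x\<^sup>2 \<partial>P) = (\<integral>x. x \<partial>\<nu>)\<^sup>2 + (\<integral>x. x\<^sup>2 \<partial>\<nu>)"
    using integral_eq_lim_dominated_by_limit(2)[OF _ int_q2P bd2 _ q2P_lim] q2_lim by simp
qed

text \<open>Taylor expansion to second order under the Levy integral. As mean and variance of
  \<open>P\<close> are the first two moments of \<open>\<nu>\<close>, centring cancels the linear
  term and scaling turns the quadratic one into -u^2/2; the third-order remainder gives the bound.
  Exhibiting an exponent \<open>z\<close> avoids a complex logarithm of the characteristic
  function.\<close>

lemma char_standardize:
  assumes P: "nonneg_law P" and [measurable_cong]: "sets \<nu> = sets borel"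
    and char: "\<And>u. char P u = exp (- (\<integral>x. 1 - iexp (u * x) \<partial>\<nu>))"
    and AE_pos: "AE x in \<nu>. 0 < x"
    and int: "integrable \<nu> (\<lambda>x. x)" "integrable \<nu> (\<lambda>x. x\<^sup>2)" "integrable \<nu> (\<lambda>x. x ^ 3)"
    and mean: "mean P = (\<integral>x. x \<partial>\<nu>)" and var: "var P = (\<integral>x. x\<^sup>2 \<partial>\<nu>)" and pos: "0 < var P"
  shows "\<exists>z. char (standardize P) u = exp z \<and>
    norm (z - complex_of_real (- u\<^sup>2 / 2)) \<le> \<bar>u\<bar> ^ 3 / 6 * ((\<integral>x. x ^ 3 \<partial>\<nu>) / sqrt (var P) ^ 3)"
proof -
  interpret P: real_distribution P using P by (rule nonneg_law_real_distribution)
  define \<sigma> where "\<sigma> = sqrt (var P)"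
  have \<sigma>: "0 < \<sigma>" "\<sigma>\<^sup>2 = var P" using pos by (auto simp: \<sigma>_def)
  define v where "v = u / \<sigma>"
  have "char (standardize P) u = (\<integral>x. iexp (- v * mean P) * iexp (v * x) \<partial>P)"
    unfolding char_def standardize_def
    using \<sigma>(1) by (subst integral_distr)
      (auto simp: v_def \<sigma>_def[symmetric] field_simps simp flip: exp_add intro!: Bochner_Integration.integral_cong)
  also have "\<dots> = iexp (- v * mean P) * char P v" by (simp add: char_def)
  finally have char_std: "char (standardize P) u = exp (- (\<i> * v * mean P) - (\<integral>x. 1 - iexp (v * x) \<partial>\<nu>))"
    by (simp add: char exp_diff exp_minus field_simps)
  let ?z = "- (\<i> * v * mean P) - (\<integral>x. 1 - iexp (v * x) \<partial>\<nu>)"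
  let ?r = "\<lambda>x. iexp (v * x) - (\<Sum>k\<le>2. (\<i> * complex_of_real (v * x)) ^ k / fact k)"
  have r_eq: "?r x = - (1 - iexp (v * x)) - \<i> * v * complex_of_real x + complex_of_real (v\<^sup>2 / 2 * x\<^sup>2)" for x
  proof -
    have sum_2: "(\<Sum>k\<le>2. c ^ k / fact k) = 1 + c + c\<^sup>2 / 2" for c :: complex
      by (simp add: numeral_2_eq_2)
    show ?thesis unfolding sum_2 by (simp add: power_mult_distrib)
  qed
  have int_i: "integrable \<nu> (\<lambda>x. 1 - iexp (v * x))"
  proof (rule Bochner_Integration.integrable_bound)
    show "integrable \<nu> (\<lambda>x. v * x)" using int(1) by simp
    show "AE x in \<nu>. norm (1 - iexp (v * x)) \<le> norm (v * x)"
      using iexp_approx1[of "v * x" 0 for x] by (auto simp: norm_minus_commute)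
  qed measurable
  have r_int: "has_bochner_integral \<nu> ?r (- (\<integral>x. 1 - iexp (v * x) \<partial>\<nu>)
      - \<i> * v * complex_of_real (\<integral>x. x \<partial>\<nu>) + complex_of_real (v\<^sup>2 / 2 * (\<integral>x. x\<^sup>2 \<partial>\<nu>)))"
    unfolding r_eq using int_i int(1,2)
    by (intro has_bochner_integral_add has_bochner_integral_diff has_bochner_integral_minus
        has_bochner_integral_mult_right has_bochner_integral_of_real has_bochner_integral_integrable)
  have "(\<integral>x. ?r x \<partial>\<nu>) = ?z + complex_of_real (v\<^sup>2 / 2 * var P)"
    unfolding has_bochner_integral_integral_eq[OF r_int] by (simp add: mean var)
  also have "v\<^sup>2 / 2 * var P = u\<^sup>2 / 2" using \<sigma> pos by (simp add: v_def power_divide field_simps)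
  finally have z: "?z - complex_of_real (- u\<^sup>2 / 2) = (\<integral>x. ?r x \<partial>\<nu>)" by simp
  have "norm (\<integral>x. ?r x \<partial>\<nu>) \<le> (\<integral>x. norm (?r x) \<partial>\<nu>)" by (rule integral_norm_bound)
  also have "\<dots> \<le> (\<integral>x. \<bar>v\<bar> ^ 3 / 6 * x ^ 3 \<partial>\<nu>)"
  proof (rule integral_mono_AE)
    show "integrable \<nu> (\<lambda>x. norm (?r x))"
      by (intro integrable_norm integrable.intros[OF r_int])
    show "AE x in \<nu>. norm (?r x) \<le> \<bar>v\<bar> ^ 3 / 6 * x ^ 3"
      using AE_pos
    proof eventually_elim
      case (elim x)
      then show ?case using iexp_approx1[of "v * x" 2]
        by (simp only: abs_mult power_mult_distrib abs_of_pos) (simp add: fact_numeral eval_nat_numeral)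
    qed
  qed (use int(3) in simp)
  also have "\<dots> = \<bar>u\<bar> ^ 3 / 6 * ((\<integral>x. x ^ 3 \<partial>\<nu>) / sqrt (var P) ^ 3)"
    using \<sigma>(1) by (simp add: v_def \<sigma>_def power_divide)
  finally show ?thesis using char_std z by (intro exI[of _ ?z]) simp
qed

section \<open>Thorin representations\<close>

text \<open>The Levy measure of a generalized gamma convolution whose Thorin measure is the image of \<open>V\<close>
  under \<open>s\<close>. Working with \<open>V\<close> avoids asking whether that image is sigma-finite.\<close>

definition thorin_levy_measure :: "'a measure \<Rightarrow> ('a \<Rightarrow> real) \<Rightarrow> real measure" where
  "thorin_levy_measure V s =
     density lborel (\<lambda>x. indicator {0<..} x * (\<integral>\<^sup>+v. ennreal (exp (- (s v * x)) / x) \<partial>V))"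

lemma sets_thorin_levy_measure[simp, measurable_cong]: "sets (thorin_levy_measure V s) = sets borel"
  by (simp add: thorin_levy_measure_def)

lemma thorin_density_measurable:
  assumes "sigma_finite_measure V" and [measurable]: "s \<in> borel_measurable V"
  shows "(\<lambda>x. indicator {0<..} x * (\<integral>\<^sup>+v. ennreal (exp (- (s v * x)) / x) \<partial>V)) \<in> borel_measurable borel"
proof -
  interpret sigma_finite_measure V by fact
  show ?thesis by measurable
qed

lemma AE_thorin_levy_measure_pos:
  assumes "sigma_finite_measure V" "s \<in> borel_measurable V"
  shows "AE x in thorin_levy_measure V s. 0 < x"
  unfolding thorin_levy_measure_def using thorin_density_measurable[OF assms]
  by (subst AE_density) (auto simp: indicator_def split: if_splits)

lemma nn_integral_thorin_levy_measure:
  assumes V: "sigma_finite_measure V" and s[measurable]: "s \<in> borel_measurable V"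
    and [measurable]: "f \<in> borel_measurable borel"
  shows "(\<integral>\<^sup>+x. f x \<partial>thorin_levy_measure V s) =
    (\<integral>\<^sup>+v. \<integral>\<^sup>+x. indicator {0<..} x * (f x * ennreal (exp (- (s v * x)) / x)) \<partial>lborel \<partial>V)"
proof -
  interpret V: sigma_finite_measure V by fact
  interpret pair_sigma_finite V lborel ..
  have "(\<integral>\<^sup>+x. f x \<partial>thorin_levy_measure V s) =
      (\<integral>\<^sup>+x. indicator {0<..} x * (\<integral>\<^sup>+v. ennreal (exp (- (s v * x)) / x) \<partial>V) * f x \<partial>lborel)"
    unfolding thorin_levy_measure_def using thorin_density_measurable[OF V s]
    by (subst nn_integral_density) auto
  also have "\<dots> = (\<integral>\<^sup>+x. \<integral>\<^sup>+v. indicator {0<..} x * (f x * ennreal (exp (- (s v * x)) / x)) \<partial>V \<partial>lborel)"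
    by (intro nn_integral_cong) (simp add: nn_integral_cmult mult_ac)
  also have "\<dots> = (\<integral>\<^sup>+v. \<integral>\<^sup>+x. indicator {0<..} x * (f x * ennreal (exp (- (s v * x)) / x)) \<partial>lborel \<partial>V)"
    by (rule Fubini') measurable
  finally show ?thesis .
qed

lemma nn_integral_exp_neg:
  assumes "0 < (c::real)"
  shows "(\<integral>\<^sup>+x. ennreal (exp (- (c * x))) * indicator {0..} x \<partial>lborel) = ennreal (1 / c)"
proof -
  have "((\<lambda>x. exp (- (c * x))) \<longlongrightarrow> 0) at_top"
    using assms by real_asymp
  then have "((\<lambda>x. - exp (- (c * x)) / c) \<longlongrightarrow> 0) at_top"
    using tendsto_divide[OF tendsto_minus tendsto_const[of c]] assms by fastforce
  moreover have "((\<lambda>x. - exp (- (c * x)) / c) has_real_derivative exp (- (c * x))) (at x)" for x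
    using assms by (auto intro!: derivative_eq_intros)
  ultimately show ?thesis
    using nn_integral_FTC_atLeast[of "\<lambda>x. exp (- (c * x))" 0 "\<lambda>x. - exp (- (c * x)) / c" 0] by simp
qed

text \<open>The factor 1/x is removed by writing the integrand as the integral of exp (- (s + y) x)
  over y from 0 to \<open>\<mu>\<close>; after the interchange what remains is the integral of 1 /
  (s + y).\<close>

lemma frullani_exp_log:
  assumes "0 < s" "0 < (\<mu>::real)"
  shows "(\<integral>\<^sup>+x. indicator {0<..} x * (ennreal (1 - exp (- (\<mu> * x))) * ennreal (exp (- (s * x)) / x)) \<partial>lborel)
    = ennreal (ln (1 + \<mu> / s))"
proof -
  have inner: "ennreal (1 - exp (- (\<mu> * x))) * ennreal (exp (- (s * x)) / x) =
      (\<integral>\<^sup>+y. ennreal (exp (- ((s + y) * x))) * indicator {0..\<mu>} y \<partial>lborel)" if "0 < x" for x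
  proof -
    have "(\<integral>\<^sup>+y. ennreal (exp (- ((s + y) * x))) * indicator {0..\<mu>} y \<partial>lborel) =
        ennreal (- exp (- ((s + \<mu>) * x)) / x - (- exp (- ((s + 0) * x)) / x))"
      using assms that
      by (intro nn_integral_FTC_Icc[where F="\<lambda>y. - exp (- ((s + y) * x)) / x"]) (auto intro!: derivative_eq_intros)
    also have "- exp (- ((s + \<mu>) * x)) / x - (- exp (- ((s + 0) * x)) / x) =
        (1 - exp (- (\<mu> * x))) * (exp (- (s * x)) / x)"
    proof -
      have "exp (- ((s + \<mu>) * x)) = exp (- (\<mu> * x)) * exp (- (s * x))"
        by (simp add: algebra_simps flip: exp_add)
      then show ?thesis by (simp add: algebra_simps diff_divide_distrib)
    qed
    also have "ennreal \<dots> = ennreal (1 - exp (- (\<mu> * x))) * ennreal (exp (- (s * x)) / x)"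
      using assms that by (intro ennreal_mult) auto
    finally show ?thesis by simp
  qed
  have "(\<integral>\<^sup>+x. indicator {0<..} x * (ennreal (1 - exp (- (\<mu> * x))) * ennreal (exp (- (s * x)) / x)) \<partial>lborel) =
      (\<integral>\<^sup>+x. \<integral>\<^sup>+y. ennreal (exp (- ((s + y) * x))) * indicator {0..\<mu>} y * indicator {0<..} x \<partial>lborel \<partial>lborel)"
    by (intro nn_integral_cong) (auto simp: inner nn_integral_multc split: split_indicator)
  also have "\<dots> = (\<integral>\<^sup>+y. \<integral>\<^sup>+x. ennreal (exp (- ((s + y) * x))) * indicator {0..\<mu>} y * indicator {0<..} x \<partial>lborel \<partial>lborel)"
    by (rule lborel_pair.Fubini') measurable
  also have "\<dots> = (\<integral>\<^sup>+y. ennreal (1 / (s + y)) * indicator {0..\<mu>} y \<partial>lborel)"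
  proof (intro nn_integral_cong)
    fix y
    have "(\<integral>\<^sup>+x. ennreal (exp (- ((s + y) * x))) * indicator {0..\<mu>} y * indicator {0<..} x \<partial>lborel) =
        (\<integral>\<^sup>+x. ennreal (exp (- ((s + y) * x))) * indicator {0..} x \<partial>lborel) * indicator {0..\<mu>} y"
    proof (subst nn_integral_multc[symmetric])
      show "(\<integral>\<^sup>+x. ennreal (exp (- ((s + y) * x))) * indicator {0..\<mu>} y * indicator {0<..} x \<partial>lborel) =
          (\<integral>\<^sup>+x. ennreal (exp (- ((s + y) * x))) * indicator {0..} x * indicator {0..\<mu>} y \<partial>lborel)"
        by (rule nn_integral_cong_AE, use AE_lborel_singleton[of 0] in eventually_elim)
           (auto split: split_indicator)
    qed measurable
    then show "(\<integral>\<^sup>+x. ennreal (exp (- ((s + y) * x))) * indicator {0..\<mu>} y * indicator {0<..} x \<partial>lborel) =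
        ennreal (1 / (s + y)) * indicator {0..\<mu>} y"
      using assms nn_integral_exp_neg[of "s + y"] by (auto split: split_indicator)
  qed
  also have "\<dots> = ennreal (ln (s + \<mu>) - ln (s + 0))"
    using assms by (intro nn_integral_FTC_Icc) (auto intro!: derivative_eq_intros)
  also have "ln (s + \<mu>) - ln (s + 0) = ln (1 + \<mu> / s)"
    using assms ln_div[of "s + \<mu>" s] by (simp add: add_divide_distrib)
  finally show ?thesis .
qed

text \<open>The factor 1/x lowers the power by one, so the moment of order k + 1 is a Gamma integral
  of value k!; the substitution x -> s x supplies the power of s.\<close>

lemma nn_integral_power_exp_neg:
  assumes s: "0 < (s::real)"
  shows "(\<integral>\<^sup>+x. indicator {0<..} x * (ennreal (x ^ Suc k) * ennreal (exp (- (s * x)) / x)) \<partial>lborel)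
    = ennreal (fact k / s ^ Suc k)"
proof -
  let ?I = "\<integral>\<^sup>+x. indicator {0<..} x * (ennreal (x ^ Suc k) * ennreal (exp (- (s * x)) / x)) \<partial>lborel"
  have "ennreal (fact k) = (\<integral>\<^sup>+x. ennreal (x ^ k * exp (- x)) * indicator {0..} x \<partial>lborel)"
    by (simp add: nn_intergal_power_times_exp_Ici)
  also have "\<dots> = ennreal s * (\<integral>\<^sup>+x. ennreal ((s * x) ^ k * exp (- (s * x))) * indicator {0..} (s * x) \<partial>lborel)"
    using s by (subst nn_integral_real_affine[where c=s and t=0]) auto
  also have "(\<integral>\<^sup>+x. ennreal ((s * x) ^ k * exp (- (s * x))) * indicator {0..} (s * x) \<partial>lborel) =
      (\<integral>\<^sup>+x. ennreal (s ^ k) * (indicator {0<..} x * (ennreal (x ^ Suc k) * ennreal (exp (- (s * x)) / x))) \<partial>lborel)"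
  proof (rule nn_integral_cong_AE, use AE_lborel_singleton[of 0] in eventually_elim)
    fix x :: real assume "x \<noteq> 0"
    then consider "x < 0" | "0 < x" by linarith
    then show "ennreal ((s * x) ^ k * exp (- (s * x))) * indicator {0..} (s * x) =
        ennreal (s ^ k) * (indicator {0<..} x * (ennreal (x ^ Suc k) * ennreal (exp (- (s * x)) / x)))"
    proof cases
      case 2
      then have "ennreal (s ^ k) * (ennreal (x ^ Suc k) * ennreal (exp (- (s * x)) / x)) =
          ennreal (s ^ k * (x ^ Suc k * (exp (- (s * x)) / x)))"
        using s by (simp only: ennreal_mult zero_le_power less_imp_le divide_nonneg_pos exp_ge_zero mult_nonneg_nonneg)
      with 2 s show ?thesis by (simp add: power_mult_distrib)
    qed (use s in \<open>auto simp: zero_le_mult_iff\<close>)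
  qed
  also have "\<dots> = ennreal (s ^ k) * ?I" by (rule nn_integral_cmult) measurable
  finally have "ennreal (fact k) = ennreal (s ^ Suc k) * ?I"
    using s by (simp add: ennreal_mult mult.assoc)
  then have "ennreal (1 / s ^ Suc k) * ennreal (fact k) = ennreal (1 / s ^ Suc k * s ^ Suc k) * ?I"
    using s by (simp only: ennreal_mult mult.assoc zero_le_divide_1_iff zero_le_power less_imp_le)
  then show ?thesis using s by (simp add: ennreal_mult'[symmetric])
qed

text \<open>Frullani's integral controls 1 - exp (- x), whereas the existence of laws asks for
  \<open>min 1 x\<close>. Since exp (- x) <= 1 / (1 + x), it is enough that min 1 x <= 2 x / (1 +
  x).\<close>

lemma min_le_one_minus_exp:
  assumes "0 \<le> (x::real)"
  shows "min 1 x \<le> 2 * (1 - exp (- x))"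
proof -
  have *: "exp (- x) \<le> 1 / (1 + x)"
    using exp_ge_add_one_self[of x] assms by (simp add: exp_minus field_simps)
  have "min 1 x * (1 + x) \<le> 2 * x"
    using assms mult_right_mono[of x 1 x] by (auto simp: min_def algebra_simps)
  then have "min 1 x \<le> 2 * (1 - 1 / (1 + x))" using assms by (simp add: field_simps)
  also have "\<dots> \<le> 2 * (1 - exp (- x))" using * by simp
  finally show ?thesis .
qed

text \<open>Kept apart from \<open>thorin\<close> because the identities between nonnegative
  integrals proved here are themselves used to establish the finiteness that \<open>thorin\<close>
  demands.\<close>

locale thorin_data =
  fixes V :: "'a measure" and s :: "'a \<Rightarrow> real"
  assumes sigma_finite: "sigma_finite_measure V" and s_meas[measurable]: "s \<in> borel_measurable V"
    and s_pos: "AE v in V. 0 < s v"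
begin

abbreviation "\<nu> \<equiv> thorin_levy_measure V s"

lemma AE_pos: "AE x in \<nu>. 0 < x"
  by (rule AE_thorin_levy_measure_pos[OF sigma_finite s_meas])

lemma nn_integral_one_minus_exp:
  assumes "0 < \<mu>"
  shows "(\<integral>\<^sup>+x. ennreal (1 - exp (- (\<mu> * x))) \<partial>\<nu>) = (\<integral>\<^sup>+v. ennreal (ln (1 + \<mu> / s v)) \<partial>V)"
  by (subst nn_integral_thorin_levy_measure[OF sigma_finite s_meas])
     (use s_pos frullani_exp_log[OF _ assms] in \<open>auto intro!: nn_integral_cong_AE\<close>)

lemma nn_integral_power:
  "(\<integral>\<^sup>+x. ennreal (x ^ Suc k) \<partial>\<nu>) = (\<integral>\<^sup>+v. ennreal (fact k / s v ^ Suc k) \<partial>V)"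
  by (subst nn_integral_thorin_levy_measure[OF sigma_finite s_meas])
     (use s_pos nn_integral_power_exp_neg in \<open>auto intro!: nn_integral_cong_AE simp del: power_Suc\<close>)

lemma integrable_power:
  assumes "(\<integral>\<^sup>+v. ennreal (1 / s v ^ Suc k) \<partial>V) < \<infinity>"
  shows "integrable \<nu> (\<lambda>x. x ^ Suc k)"
    "ennreal (\<integral>x. x ^ Suc k \<partial>\<nu>) = ennreal (fact k) * (\<integral>\<^sup>+v. ennreal (1 / s v ^ Suc k) \<partial>V)"
proof -
  have "(\<integral>\<^sup>+v. ennreal (fact k / s v ^ Suc k) \<partial>V) = (\<integral>\<^sup>+v. ennreal (fact k) * ennreal (1 / s v ^ Suc k) \<partial>V)"
    by (rule nn_integral_cong_AE, use s_pos in eventually_elim) (simp flip: ennreal_mult')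
  then have eq: "(\<integral>\<^sup>+x. ennreal (x ^ Suc k) \<partial>\<nu>) = ennreal (fact k) * (\<integral>\<^sup>+v. ennreal (1 / s v ^ Suc k) \<partial>V)"
    unfolding nn_integral_power by (subst (asm) nn_integral_cmult) auto
  have nonneg: "AE x in \<nu>. 0 \<le> x ^ Suc k" using AE_pos by eventually_elim simp
  have "(\<integral>\<^sup>+x. ennreal (x ^ Suc k) \<partial>\<nu>) < \<infinity>"
    unfolding eq using assms by (simp add: ennreal_mult_less_top)
  then show int: "integrable \<nu> (\<lambda>x. x ^ Suc k)"
    using nonneg by (intro integrableI_nonneg) auto
  show "ennreal (\<integral>x. x ^ Suc k \<partial>\<nu>) = ennreal (fact k) * (\<integral>\<^sup>+v. ennreal (1 / s v ^ Suc k) \<partial>V)"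
    using nn_integral_eq_integral[OF int nonneg] eq by simp
qed

end

text \<open>Finiteness at \<open>\<mu> = 1\<close> makes \<open>min 1 x\<close> integrable, and that
  weight dominates the exponent at every positive \<open>\<mu>\<close> up to a constant
  factor.\<close>

locale thorin = thorin_data +
  assumes log_finite: "(\<integral>\<^sup>+v. ennreal (ln (1 + 1 / s v)) \<partial>V) < \<infinity>"
begin

lemma integrable_min: "integrable \<nu> (\<lambda>x. min 1 x)"
proof (rule Bochner_Integration.integrable_bound)
  have "integrable \<nu> (\<lambda>x. 1 - exp (- x))"
    using nn_integral_one_minus_exp[of 1] log_finite AE_pos by (intro integrableI_nonneg) auto
  then show "integrable \<nu> (\<lambda>x. 2 * (1 - exp (- x)))" by (rule integrable_mult_right)
  show "AE x in \<nu>. norm (min 1 x) \<le> norm (2 * (1 - exp (- x)))"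
    using AE_pos by eventually_elim (use min_le_one_minus_exp in \<open>auto simp: less_imp_le\<close>)
qed simp

lemma integrable_one_minus_exp:
  assumes "0 < \<mu>"
  shows "integrable \<nu> (\<lambda>x. 1 - exp (- (\<mu> * x)))"
proof (rule Bochner_Integration.integrable_bound)
  show "integrable \<nu> (\<lambda>x. (2 + \<mu>) * min 1 x)" using integrable_min by simp
  show "AE x in \<nu>. norm (1 - exp (- (\<mu> * x))) \<le> norm ((2 + \<mu>) * min 1 x)"
    using AE_pos
  proof eventually_elim
    case (elim x)
    have "1 - exp (- (complex_of_real \<mu> * complex_of_real x)) = complex_of_real (1 - exp (- (\<mu> * x)))"
      by (simp flip: exp_of_real)
    then have "\<bar>1 - exp (- (\<mu> * x))\<bar> \<le> (2 + \<mu>) * min 1 x"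
      using norm_one_minus_exp_min[of "of_real \<mu>" x] assms elim by (simp only: norm_of_real) simp
    then show ?case using assms elim by (simp add: abs_mult)
  qed
qed simp

lemma integral_one_minus_exp:
  assumes "0 < \<mu>"
  shows "ennreal (\<integral>x. 1 - exp (- (\<mu> * x)) \<partial>\<nu>) = (\<integral>\<^sup>+v. ennreal (ln (1 + \<mu> / s v)) \<partial>V)"
proof -
  have "AE x in \<nu>. 0 \<le> 1 - exp (- (\<mu> * x))"
    using AE_pos by eventually_elim (use assms in auto)
  then show ?thesis
    using nn_integral_eq_integral[OF integrable_one_minus_exp[OF assms]]
    by (simp add: nn_integral_one_minus_exp[OF assms])
qed

lemma integral_one_minus_exp_nonneg:
  assumes "0 < \<mu>"
  shows "0 \<le> (\<integral>x. 1 - exp (- (\<mu> * x)) \<partial>\<nu>)"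
  using AE_pos assms by (intro integral_nonneg_AE) auto

lemma law_exists:
  "\<exists>P. nonneg_law P \<and> (\<forall>\<mu>>0. laplace P \<mu> = exp (- (\<integral>x. 1 - exp (- (\<mu> * x)) \<partial>\<nu>))) \<and>
    (\<forall>u. char P u = exp (- (\<integral>x. 1 - iexp (u * x) \<partial>\<nu>)))"
proof -
  obtain P where P: "nonneg_law P" "\<And>w. 0 \<le> Re w \<Longrightarrow>
      claplace P w = exp (- (\<integral>x. 1 - exp (- (w * complex_of_real x)) \<partial>\<nu>))"
    using levy_khintchine_law_exists[OF thorin_density_measurable[OF sigma_finite s_meas]
        thorin_levy_measure_def AE_pos integrable_min] by blast
  have "laplace P \<mu> = exp (- (\<integral>x. 1 - exp (- (\<mu> * x)) \<partial>\<nu>))" if "0 < \<mu>" for \<mu>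
  proof -
    have "(\<integral>x. 1 - exp (- (complex_of_real \<mu> * complex_of_real x)) \<partial>\<nu>) = of_real (\<integral>x. 1 - exp (- (\<mu> * x)) \<partial>\<nu>)"
      unfolding integral_complex_of_real[symmetric] by (simp flip: exp_of_real)
    then have "complex_of_real (laplace P \<mu>) = of_real (exp (- (\<integral>x. 1 - exp (- (\<mu> * x)) \<partial>\<nu>)))"
      using P(2)[of "of_real \<mu>"] that by (simp add: of_real_laplace flip: exp_of_real)
    then show ?thesis by (simp only: of_real_eq_iff)
  qed
  moreover have "char P u = exp (- (\<integral>x. 1 - iexp (u * x) \<partial>\<nu>))" for u
    unfolding char_eq_claplace by (subst P(2)) (auto simp: mult.assoc)
  ultimately show ?thesis using P(1) by blast
qed

end

section \<open>The CGMY time change\<close>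

lemma prob_space_gamma_law:
  assumes "0 < k"
  shows "prob_space (gamma_law k)"
proof (rule prob_spaceI)
  have [measurable]: "gamma_density k \<in> borel_measurable borel" unfolding gamma_density_def by measurable
  have "(\<integral>\<^sup>+x. ennreal (gamma_density k x) \<partial>lborel) =
      (\<integral>\<^sup>+x. ennreal (1 / Gamma k) * ennreal (indicator {0..} x * x powr (k - 1) / exp x) \<partial>lborel)"
  proof (rule nn_integral_cong)
    fix x :: real
    have "gamma_density k x = 1 / Gamma k * (indicator {0..} x * x powr (k - 1) / exp x)"
      by (auto simp: gamma_density_def exp_minus field_simps split: split_indicator)
    then show "ennreal (gamma_density k x) = ennreal (1 / Gamma k) * ennreal (indicator {0..} x * x powr (k - 1) / exp x)"
      using assms by (simp only:) (intro ennreal_mult', simp add: Gamma_real_pos less_imp_le)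
  qed
  also have "\<dots> = ennreal (1 / Gamma k) * ennreal (Gamma k)"
    using assms by (subst nn_integral_cmult) (auto simp: Gamma_conv_nn_integral_real)
  also have "\<dots> = 1"
    using Gamma_real_pos[OF assms] by (simp flip: ennreal_mult')
  finally show "emeasure (gamma_law k) (space (gamma_law k)) = 1"
    by (simp add: gamma_law_def emeasure_density)
qed

lemma AE_gamma_law_pos: "AE x in gamma_law k. 0 < x"
proof -
  have [measurable]: "gamma_density k \<in> borel_measurable borel" unfolding gamma_density_def by measurable
  show ?thesis unfolding gamma_law_def by (subst AE_density) (auto simp: gamma_density_def)
qed

lemma sets_gamma_law[measurable_cong, simp]: "sets (gamma_law k) = sets borel"
  by (simp add: gamma_law_def)

lemma nonneg_law_ratio_law:
  assumes "0 < Y"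
  shows "nonneg_law (ratio_law Y)"
proof -
  interpret A: prob_space "gamma_law (Y/2)" using assms by (intro prob_space_gamma_law) simp
  interpret B: prob_space "gamma_law (1/2)" by (intro prob_space_gamma_law) simp
  interpret AB: pair_prob_space "gamma_law (Y/2)" "gamma_law (1/2)" ..
  have "AE z in gamma_law (Y/2) \<Otimes>\<^sub>M gamma_law (1/2). 0 \<le> fst z / snd z"
  proof (rule AB.AE_pair_measure)
    show "AE x in gamma_law (Y/2). AE y in gamma_law (1/2). 0 \<le> fst (x, y) / snd (x, y)"
      using AE_gamma_law_pos[of "Y/2"]
    proof eventually_elim
      case (elim x)
      show ?case using AE_gamma_law_pos[of "1/2"] by eventually_elim (use elim in auto)
    qed
  qed measurable
  then show ?thesis
    unfolding nonneg_law_def ratio_law_def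
    by (auto intro!: AB.prob_space_distr simp: AE_distr_iff case_prod_beta')
qed

lemma nn_integral_powr_from_0:
  assumes "-1 < a" "0 \<le> (c::real)"
  shows "(\<integral>\<^sup>+x. ennreal (indicator {0..c} x * x powr a) \<partial>lborel) = ennreal (c powr (a + 1) / (a + 1))"
  using nn_integral_has_integral_lebesgue[OF _ has_integral_powr_from_0[OF assms]] by simp

lemma nn_integral_powr_to_inf:
  assumes "e < -1" "0 < (a::real)"
  shows "(\<integral>\<^sup>+x. ennreal (indicator {a<..} x * x powr e) \<partial>lborel) = ennreal (a powr (e + 1) / (- e - 1))"
proof -
  have "(\<integral>\<^sup>+x. ennreal (indicator {a<..} x * x powr e) \<partial>lborel) = (\<integral>\<^sup>+x. ennreal (indicator {a..} x * x powr e) \<partial>lborel)"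
    by (rule nn_integral_cong_AE, use AE_lborel_singleton[of a] in eventually_elim) (auto split: split_indicator)
  also have "\<dots> = ennreal (- (a powr (e + 1)) / (e + 1))"
    using nn_integral_has_integral_lebesgue[OF _ has_integral_powr_to_inf[OF assms]] by simp
  also have "- (a powr (e + 1)) / (e + 1) = a powr (e + 1) / (- e - 1)"
    using minus_divide_divide[of "a powr (e + 1)" "e + 1"] by simp
  finally show ?thesis .
qed

lemma nn_integral_Gamma_scaled:
  assumes x: "0 < x" and b: "0 < (b::real)"
  shows "(\<integral>\<^sup>+z. ennreal (indicator {0<..} z * z powr (b - 1) * exp (- (z * x))) \<partial>lborel) = ennreal (Gamma b / x powr b)"
    (is "?I = _")
proof -
  have "ennreal (Gamma b) = (\<integral>\<^sup>+z. ennreal (indicator {0..} z * z powr (b - 1) / exp z) \<partial>lborel)"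
    using b by (rule Gamma_conv_nn_integral_real)
  also have "\<dots> = ennreal x * (\<integral>\<^sup>+z. ennreal (indicator {0..} (x * z) * (x * z) powr (b - 1) / exp (x * z)) \<partial>lborel)"
    using x by (subst nn_integral_real_affine[where c=x and t=0]) auto
  also have "(\<integral>\<^sup>+z. ennreal (indicator {0..} (x * z) * (x * z) powr (b - 1) / exp (x * z)) \<partial>lborel) =
      (\<integral>\<^sup>+z. ennreal (x powr (b - 1)) * ennreal (indicator {0<..} z * z powr (b - 1) * exp (- (z * x))) \<partial>lborel)"
  proof (rule nn_integral_cong)
    fix z :: real
    have "indicator {0..} (x * z) * (x * z) powr (b - 1) / exp (x * z) =
        x powr (b - 1) * (indicator {0<..} z * z powr (b - 1) * exp (- (z * x)))"
      using x by (cases "z = 0") (auto simp: zero_le_mult_iff powr_mult exp_minus field_simps split: split_indicator)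
    then show "ennreal (indicator {0..} (x * z) * (x * z) powr (b - 1) / exp (x * z)) =
        ennreal (x powr (b - 1)) * ennreal (indicator {0<..} z * z powr (b - 1) * exp (- (z * x)))"
      by (simp add: ennreal_mult')
  qed
  also have "\<dots> = ennreal (x powr (b - 1)) * ?I" by (rule nn_integral_cmult) measurable
  also have "ennreal x * (ennreal (x powr (b - 1)) * ?I) = ennreal (x powr b) * ?I"
    using x by (simp add: mult.assoc[symmetric] ennreal_mult'[symmetric] powr_mult_base)
  finally have "ennreal (1 / x powr b) * ennreal (Gamma b) = ennreal (1 / x powr b) * ennreal (x powr b) * ?I"
    by (simp add: mult.assoc)
  then show ?thesis using x by (simp add: ennreal_mult'[symmetric])
qed

section \<open>The mixing measure and its Levy density\<close>

locale cgmy =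
  fixes C G M Y t :: real
  assumes C: "0 < C" and G: "0 \<le> G" and M: "0 \<le> M" and Y: "0 < Y" "Y < 2" and t: "0 < t"
begin

text \<open>Here \<open>c\<close> is the constant \<open>C~\<close> of the statement. A point \<open>(z, r)\<close> of the mixing measure stands for
  a value of \<open>(Z, R)\<close> with \<open>z\<close> not normalised, and \<open>rate (z, r)\<close> is the reciprocal of the variable
  whose logarithm appears in the Laplace exponent.\<close>

definition c :: real where "c = t * C * 2 powr (Y/2 - 1) / Gamma Y"

definition shift :: "real \<Rightarrow> real" where "shift r = (G * M + ((G + M) / 2)\<^sup>2 * r) / 2"

definition rate :: "real \<times> real \<Rightarrow> real" where "rate v = shift (snd v) + fst v"

definition mixing :: "real set \<Rightarrow> (real \<times> real) measure" where
  "mixing A = density lborel (\<lambda>z. ennreal (indicator A z * (c * z powr (Y/2 - 1)))) \<Otimes>\<^sub>M ratio_law Y"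

lemma c_pos: "0 < c"
  unfolding c_def using C Y t by (auto intro!: divide_pos_pos mult_pos_pos Gamma_real_pos)

sublocale R: real_distribution "ratio_law Y"
  using nonneg_law_ratio_law[OF Y(1)] by (rule nonneg_law_real_distribution)

lemma AE_ratio_nonneg: "AE r in ratio_law Y. 0 \<le> r"
  using nonneg_law_ratio_law[OF Y(1)] by (simp add: nonneg_law_def)

lemma shift_nonneg: "0 \<le> r \<Longrightarrow> 0 \<le> shift r"
  using G M by (simp add: shift_def)

lemma measurable_shift[measurable]: "shift \<in> borel_measurable borel"
  unfolding shift_def by measurable

lemma measurable_rate[measurable]: "rate \<in> borel_measurable (borel \<Otimes>\<^sub>M borel)"
  unfolding rate_def by measurable

lemma sets_mixing[measurable_cong]: "sets (mixing A) = sets (borel \<Otimes>\<^sub>M borel)"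
  unfolding mixing_def by (intro sets_pair_measure_cong) auto

lemma sigma_finite_mixing_fst:
  "A \<in> sets borel \<Longrightarrow> sigma_finite_measure (density lborel (\<lambda>z. ennreal (indicator A z * (c * z powr (Y/2 - 1)))))"
  by (subst sigma_finite_measure.sigma_finite_iff_density_finite[OF sigma_finite_lborel]) auto

lemma nn_integral_mixing:
  assumes [measurable]: "A \<in> sets borel" "f \<in> borel_measurable (borel \<Otimes>\<^sub>M borel)"
  shows "(\<integral>\<^sup>+v. f v \<partial>mixing A) =
    (\<integral>\<^sup>+z. ennreal (indicator A z * (c * z powr (Y/2 - 1))) * (\<integral>\<^sup>+r. f (z, r) \<partial>ratio_law Y) \<partial>lborel)"
  unfolding mixing_def
  by (subst R.nn_integral_fst[symmetric]) (auto simp: nn_integral_density)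

lemma nn_integral_mixing_union:
  assumes [measurable]: "A \<in> sets borel" "B \<in> sets borel" "f \<in> borel_measurable (borel \<Otimes>\<^sub>M borel)" and "A \<inter> B = {}"
  shows "(\<integral>\<^sup>+v. f v \<partial>mixing (A \<union> B)) = (\<integral>\<^sup>+v. f v \<partial>mixing A) + (\<integral>\<^sup>+v. f v \<partial>mixing B)"
proof -
  have "ennreal (indicator (A \<union> B) z * (c * z powr (Y/2 - 1))) * g =
      ennreal (indicator A z * (c * z powr (Y/2 - 1))) * g + ennreal (indicator B z * (c * z powr (Y/2 - 1))) * g" for z g
    using assms(4) by (auto split: split_indicator)
  then show ?thesis by (simp add: nn_integral_mixing nn_integral_add)
qed

text \<open>Positivity of the rate has to come from z, because the shift is identically 0 when
  \<open>G = M = 0\<close>. This is why 0 is excluded from \<open>A\<close>.\<close>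

lemma thorin_data_mixing:
  assumes [measurable]: "A \<in> sets borel" and A: "A \<subseteq> {0<..}"
  shows "thorin_data (mixing A) rate"
proof (rule thorin_data.intro)
  let ?D = "density lborel (\<lambda>z. ennreal (indicator A z * (c * z powr (Y/2 - 1))))"
  interpret D: sigma_finite_measure ?D by (rule sigma_finite_mixing_fst) fact
  interpret DR: pair_sigma_finite ?D "ratio_law Y" ..
  show "sigma_finite_measure (mixing A)" unfolding mixing_def ..
  show "rate \<in> borel_measurable (mixing A)" by measurable
  show "AE v in mixing A. 0 < rate v"
    unfolding mixing_def
  proof (rule DR.AE_pair_measure)
    have "AE z in ?D. z \<in> A" by (subst AE_density) (auto split: split_indicator)
    then show "AE z in ?D. AE r in ratio_law Y. 0 < rate (z, r)"
    proof eventually_elim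
      case (elim z)
      show ?case using AE_ratio_nonneg
        by eventually_elim (use elim A in \<open>auto simp: rate_def intro!: add_nonneg_pos shift_nonneg\<close>)
    qed
  qed measurable
qed

lemma nu_T_nonneg: "0 \<le> nu_T C G M Y x"
  unfolding nu_T_def Let_def using C Y
  by (intro mult_nonneg_nonneg divide_nonneg_nonneg integral_nonneg) (auto simp: Gamma_real_pos less_imp_le)

lemma nu_T_measurable[measurable]: "nu_T C G M Y \<in> borel_measurable borel"
  unfolding nu_T_def Let_def by measurable

lemma nu_T_eq:
  "t * nu_T C G M Y x = c * Gamma (Y/2) / x powr (1 + Y/2) *
     (exp (- (G * M * x / 2)) * (\<integral>r. exp (- (((G + M) / 2)\<^sup>2 * x / 2) * r) \<partial>ratio_law Y))"
proof -
  have "((G + M) / 2)\<^sup>2 - ((G - M) / 2)\<^sup>2 = G * M" by (simp add: power2_eq_square field_simps)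
  then show ?thesis unfolding nu_T_def Let_def c_def by simp
qed

text \<open>Integrating out z produces \<open>Gamma (Y/2) / x powr (Y/2)\<close>: this is the Gamma
  factor of \<open>nu_T\<close>, absent from \<open>c\<close>, and together with the explicit 1/x it
  gives the power 1 + Y/2. Integrating out r gives the expectation in \<open>nu_T\<close>, and the
  difference of the two squared drift parameters is \<open>G * M\<close>.\<close>

lemma mixing_density:
  assumes x: "0 < x"
  shows "(\<integral>\<^sup>+v. ennreal (exp (- (rate v * x)) / x) \<partial>mixing {0<..}) = ennreal (t * nu_T C G M Y x)"
proof -
  let ?I = "\<integral>r. exp (- (((G + M) / 2)\<^sup>2 * x / 2) * r) \<partial>ratio_law Y"
  define E where "E = exp (- (G * M * x / 2)) * ?I"
  have E_nonneg: "0 \<le> E" unfolding E_def by (intro mult_nonneg_nonneg integral_nonneg) auto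
  have inner: "(\<integral>\<^sup>+r. ennreal (exp (- (rate (z, r) * x)) / x) \<partial>ratio_law Y) = ennreal (exp (- (z * x)) / x) * ennreal E" for z
  proof -
    have eq: "exp (- (rate (z, r) * x)) / x =
        exp (- (z * x)) / x * (exp (- (G * M * x / 2)) * exp (- (((G + M) / 2)\<^sup>2 * x / 2) * r))" for r
      by (simp add: rate_def shift_def field_simps flip: exp_add)
    have int: "integrable (ratio_law Y) (\<lambda>r. exp (- (((G + M) / 2)\<^sup>2 * x / 2) * r))"
      using AE_ratio_nonneg x
      by (intro R.integrable_const_bound[where B=1]) (auto elim!: eventually_mono)
    have "(\<integral>\<^sup>+r. ennreal (exp (- (rate (z, r) * x)) / x) \<partial>ratio_law Y) =
        ennreal (exp (- (z * x)) / x * E)"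
      unfolding eq E_def using int x by (subst nn_integral_eq_integral) auto
    then show ?thesis using x by (simp only:) (intro ennreal_mult', simp)
  qed
  have "(\<integral>\<^sup>+v. ennreal (exp (- (rate v * x)) / x) \<partial>mixing {0<..}) =
      (\<integral>\<^sup>+z. ennreal (indicator {0<..} z * (c * z powr (Y/2 - 1))) * (ennreal (exp (- (z * x)) / x) * ennreal E) \<partial>lborel)"
    by (subst nn_integral_mixing) (auto simp: inner)
  also have "\<dots> = (\<integral>\<^sup>+z. ennreal (c / x * E) * ennreal (indicator {0<..} z * z powr (Y/2 - 1) * exp (- (z * x))) \<partial>lborel)"
    using x c_pos E_nonneg by (intro nn_integral_cong) (auto simp: mult_ac simp flip: ennreal_mult split: split_indicator)
  also have "\<dots> = ennreal (c / x * E) * ennreal (Gamma (Y/2) / x powr (Y/2))"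
    using x Y by (subst nn_integral_cmult) (auto simp: nn_integral_Gamma_scaled)
  also have "\<dots> = ennreal (c / x * E * (Gamma (Y/2) / x powr (Y/2)))"
    using x c_pos E_nonneg by (intro ennreal_mult'[symmetric]) simp
  also have "c / x * E * (Gamma (Y/2) / x powr (Y/2)) = t * nu_T C G M Y x"
    unfolding nu_T_eq E_def[symmetric] using x by (simp add: powr_add)
  finally show ?thesis .
qed

text \<open>Frullani read backwards: a logarithmic integral over the mixture becomes one against an
  explicit density. It yields first the finiteness of the exponents and later the identification
  with the given law.\<close>

lemma nn_integral_log_mixing_total:
  assumes "0 < \<mu>"
  shows "(\<integral>\<^sup>+v. ennreal (ln (1 + \<mu> / rate v)) \<partial>mixing {0<..}) =
    (\<integral>\<^sup>+x. ennreal (indicator {0<..} x * ((1 - exp (- (\<mu> * x))) * (t * nu_T C G M Y x))) \<partial>lborel)"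
proof -
  interpret thorin_data "mixing {0<..}" rate by (rule thorin_data_mixing) auto
  have "\<nu> = density lborel (\<lambda>x. indicator {0<..} x * ennreal (t * nu_T C G M Y x))"
    unfolding thorin_levy_measure_def
    using thorin_density_measurable[OF sigma_finite s_meas] mixing_density
    by (intro density_cong) (auto split: split_indicator)
  then show ?thesis
    unfolding nn_integral_one_minus_exp[OF assms, symmetric]
    using t assms nu_T_nonneg
    by (auto simp: nn_integral_density mult.commute simp flip: ennreal_mult intro!: nn_integral_cong split: split_indicator)
qed

text \<open>Both exponential factors of \<open>nu_T\<close> are at most 1, leaving x^(-1 - Y/2).
  Below 1 the factor 1 - exp (- x) <= x improves this to x^(- Y/2), integrable as Y < 2; above 1 it
  is integrable as Y > 0.\<close>

lemma log_mixing_total_finite: "(\<integral>\<^sup>+v. ennreal (ln (1 + 1 / rate v)) \<partial>mixing {0<..}) < \<infinity>"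
proof -
  define K where "K = c * Gamma (Y/2)"
  have K: "0 \<le> K" using c_pos Y by (simp add: K_def Gamma_real_pos less_imp_le)
  have bound: "t * nu_T C G M Y x \<le> K * x powr (- 1 - Y/2)" if "0 < x" for x
  proof -
    have "(\<integral>r. exp (- (((G + M) / 2)\<^sup>2 * x / 2) * r) \<partial>ratio_law Y) \<le> (\<integral>r. 1 \<partial>ratio_law Y)"
      using AE_ratio_nonneg that
      by (intro integral_mono_AE R.integrable_const_bound[where B=1]) (auto elim!: eventually_mono)
    then have "exp (- (G * M * x / 2)) * (\<integral>r. exp (- (((G + M) / 2)\<^sup>2 * x / 2) * r) \<partial>ratio_law Y) \<le> 1 * 1"
      using G M that R.prob_space by (intro mult_mono) auto
    then have "t * nu_T C G M Y x \<le> K / x powr (1 + Y/2) * 1"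
      unfolding nu_T_eq K_def[symmetric] using K by (intro mult_left_mono) auto
    moreover have "x powr (- 1 - Y/2) = 1 / x powr (1 + Y/2)"
      by (simp flip: powr_minus_divide)
    ultimately show ?thesis by simp
  qed
  have "indicator {0<..} x * ((1 - exp (- (1 * x))) * (t * nu_T C G M Y x)) \<le>
      K * (indicator {0..1} x * x powr (- Y/2)) + K * (indicator {1<..} x * x powr (- 1 - Y/2))" for x
  proof -
    consider "x \<le> 0" | "0 < x" "x \<le> 1" | "1 < x" by linarith
    then show ?thesis
    proof cases
      case 1
      then show ?thesis using K by (auto split: split_indicator)
    next
      case 2
      have "(1 - exp (- x)) * (t * nu_T C G M Y x) \<le> x * (K * x powr (- 1 - Y/2))"
        using 2 t nu_T_nonneg exp_ge_add_one_self[of "- x"] by (intro mult_mono[OF _ bound]) auto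
      also have "\<dots> = K * x powr (- Y/2)"
        using 2 powr_mult_base[of x "- 1 - Y/2"] by simp
      finally show ?thesis using 2 by simp
    next
      case 3
      have "(1 - exp (- x)) * (t * nu_T C G M Y x) \<le> 1 * (K * x powr (- 1 - Y/2))"
        using 3 t nu_T_nonneg by (intro mult_mono[OF _ bound]) auto
      then show ?thesis using 3 by simp
    qed
  qed
  then have "(\<integral>\<^sup>+v. ennreal (ln (1 + 1 / rate v)) \<partial>mixing {0<..}) \<le>
      (\<integral>\<^sup>+x. ennreal (K * (indicator {0..1} x * x powr (- Y/2)) + K * (indicator {1<..} x * x powr (- 1 - Y/2))) \<partial>lborel)"
    by (subst nn_integral_log_mixing_total) (auto intro!: nn_integral_mono ennreal_leI)
  also have "\<dots> = (\<integral>\<^sup>+x. ennreal K * ennreal (indicator {0..1} x * x powr (- Y/2)) +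
      ennreal K * ennreal (indicator {1<..} x * x powr (- 1 - Y/2)) \<partial>lborel)"
    using K by (intro nn_integral_cong) (simp add: ennreal_mult')
  also have "\<dots> = ennreal K * ennreal (1 powr (- Y/2 + 1) / (- Y/2 + 1)) +
      ennreal K * ennreal (1 powr (- 1 - Y/2 + 1) / (- (- 1 - Y/2) - 1))"
    using Y by (subst nn_integral_add; (subst nn_integral_cmult)?)
      (auto simp: nn_integral_cmult nn_integral_powr_from_0 nn_integral_powr_to_inf)
  also have "\<dots> < \<infinity>" by (simp add: ennreal_mult_less_top)
  finally show ?thesis .
qed

lemma thorin_mixing:
  assumes [measurable]: "A \<in> sets borel" and A: "A \<subseteq> {0<..}"
  shows "thorin (mixing A) rate"
proof -
  interpret thorin_data "mixing A" rate using assms by (rule thorin_data_mixing)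
  have "(\<integral>\<^sup>+v. ennreal (ln (1 + 1 / rate v)) \<partial>mixing A) \<le> (\<integral>\<^sup>+v. ennreal (ln (1 + 1 / rate v)) \<partial>mixing (A \<union> ({0<..} - A)))"
    by (subst nn_integral_mixing_union) auto
  also have "A \<union> ({0<..} - A) = {0<..}" using A by blast
  finally show ?thesis using log_mixing_total_finite
    by (intro thorin.intro thorin_data_axioms thorin_axioms.intro) (auto intro: order.strict_trans1)
qed

section \<open>The two laws of the decomposition\<close>

text \<open>For \<open>A\<close> inside the positive half-line the choice is unambiguous, since the
  Laplace transform determines a law on the half-line.\<close>

definition thorin_law :: "real set \<Rightarrow> real measure" where
  "thorin_law A = (SOME P. nonneg_law P \<and>
     (\<forall>\<mu>>0. laplace P \<mu> = exp (- (\<integral>x. 1 - exp (- (\<mu> * x)) \<partial>thorin_levy_measure (mixing A) rate))) \<and>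
     (\<forall>u. char P u = exp (- (\<integral>x. 1 - iexp (u * x) \<partial>thorin_levy_measure (mixing A) rate))))"

lemma thorin_law:
  assumes "A \<in> sets borel" "A \<subseteq> {0<..}"
  shows nonneg_thorin_law: "nonneg_law (thorin_law A)"
    and laplace_thorin_law: "\<And>\<mu>. 0 < \<mu> \<Longrightarrow>
      laplace (thorin_law A) \<mu> = exp (- (\<integral>x. 1 - exp (- (\<mu> * x)) \<partial>thorin_levy_measure (mixing A) rate))"
    and char_thorin_law: "\<And>u. char (thorin_law A) u = exp (- (\<integral>x. 1 - iexp (u * x) \<partial>thorin_levy_measure (mixing A) rate))"
  using someI_ex[OF thorin.law_exists[OF thorin_mixing[OF assms]], folded thorin_law_def] by blast+

lemma ln_laplace_thorin_law:
  assumes A: "A \<in> sets borel" "A \<subseteq> {0<..}" and \<mu>: "0 < \<mu>"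
  shows "0 \<le> - ln (laplace (thorin_law A) \<mu>)"
    "ennreal (- ln (laplace (thorin_law A) \<mu>)) = (\<integral>\<^sup>+v. ennreal (ln (1 + \<mu> / rate v)) \<partial>mixing A)"
proof -
  interpret thorin "mixing A" rate using A by (rule thorin_mixing)
  have "- ln (laplace (thorin_law A) \<mu>) = (\<integral>x. 1 - exp (- (\<mu> * x)) \<partial>\<nu>)"
    using laplace_thorin_law[OF A \<mu>] by simp
  then show "0 \<le> - ln (laplace (thorin_law A) \<mu>)"
    "ennreal (- ln (laplace (thorin_law A) \<mu>)) = (\<integral>\<^sup>+v. ennreal (ln (1 + \<mu> / rate v)) \<partial>mixing A)"
    using integral_one_minus_exp[OF \<mu>] integral_one_minus_exp_nonneg[OF \<mu>] by auto
qed

lemma ggc_thorin_law: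
  assumes A: "A \<in> sets borel" "A \<subseteq> {0<..}"
  shows "ggc (thorin_law A)"
  unfolding ggc_def
\<comment> \<open>The witnesses are fixed by unification below: drift 0 and, as Thorin measure, the
  image of \<open>mixing A\<close> under \<open>rate\<close>.\<close>
proof (intro conjI exI allI impI)
  interpret thorin_data "mixing A" rate using A by (rule thorin_data_mixing)
  show "nonneg_law (thorin_law A)" using A by (rule nonneg_thorin_law)
  show "sets (distr (mixing A) borel rate) = sets borel" by simp
  fix \<mu> :: real assume \<mu>: "0 < \<mu>"
  have "(\<integral>\<^sup>+v. indicator {0<..} (rate v) * ennreal (ln (1 + \<mu> / rate v)) \<partial>mixing A) =
      (\<integral>\<^sup>+v. ennreal (ln (1 + \<mu> / rate v)) \<partial>mixing A)"
    by (rule nn_integral_cong_AE, use s_pos in eventually_elim) simp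
  then show "ennreal (- ln (laplace (thorin_law A) \<mu>)) = ennreal (0 * \<mu>) +
      (\<integral>\<^sup>+s. indicator {0<..} s * ennreal (ln (1 + \<mu> / s)) \<partial>distr (mixing A) borel rate)"
    using ln_laplace_thorin_law(2)[OF A \<mu>] by (subst nn_integral_distr) auto
qed simp

lemma thorin_law_convolution:
  assumes P: "subordinator_law (nu_T C G M Y) t P" and L: "0 < L"
  shows "thorin_law {0<..L} \<star> thorin_law {L<..} = P"
proof (rule nonneg_law_laplace_eqI)
  have A: "{0<..L} \<in> sets borel" "{0<..L} \<subseteq> {0<..}" and B: "{L<..} \<in> sets borel" "{L<..} \<subseteq> {0<..}"
    using L by auto
  note laws = nonneg_thorin_law[OF A] nonneg_thorin_law[OF B]
  show "nonneg_law (thorin_law {0<..L} \<star> thorin_law {L<..})" using laws by (rule nonneg_law_convolution)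
  show "nonneg_law P" using P by (simp add: subordinator_law_def)
  fix \<mu> :: real assume \<mu>: "0 < \<mu>"
  define p where "p = - ln (laplace (thorin_law {0<..L}) \<mu>)"
  define q where "q = - ln (laplace (thorin_law {L<..}) \<mu>)"
  have lap: "laplace (thorin_law {0<..L}) \<mu> = exp (- p)" "laplace (thorin_law {L<..}) \<mu> = exp (- q)"
    using laplace_thorin_law[OF A \<mu>] laplace_thorin_law[OF B \<mu>] by (auto simp: p_def q_def)
  have pq: "0 \<le> p" "0 \<le> q"
    unfolding p_def q_def using ln_laplace_thorin_law(1)[OF A \<mu>] ln_laplace_thorin_law(1)[OF B \<mu>] by auto
  have un: "{0<..L} \<union> {L<..} = {0<..}" using L by auto
  have "ennreal p + ennreal q = (\<integral>\<^sup>+v. ennreal (ln (1 + \<mu> / rate v)) \<partial>mixing {0<..})"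
    unfolding p_def q_def ln_laplace_thorin_law(2)[OF A \<mu>] ln_laplace_thorin_law(2)[OF B \<mu>] un[symmetric]
    by (rule nn_integral_mixing_union[symmetric]) auto
  also have "\<dots> = (\<integral>\<^sup>+x. ennreal (indicator {0<..} x * ((1 - exp (- (\<mu> * x))) * (t * nu_T C G M Y x))) \<partial>lborel)"
    by (rule nn_integral_log_mixing_total[OF \<mu>])
  \<comment> \<open>The extended integral equals the finite number p + q, so passing to the
    real-valued integral in \<open>subordinator_law\<close> does not collapse an infinite value to
    0.\<close>
  finally have "enn2real (ennreal (p + q)) =
      (\<integral>x. indicator {0<..} x * ((1 - exp (- (\<mu> * x))) * (t * nu_T C G M Y x)) \<partial>lborel)"
    using pq t \<mu> nu_T_nonneg
    by (subst integral_eq_nn_integral) (auto split: split_indicator)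
  also have "\<dots> = (\<integral>x. t * (indicator {0<..} x * ((1 - exp (- (\<mu> * x))) * nu_T C G M Y x)) \<partial>lborel)"
    by (simp add: mult_ac)
  also have "\<dots> = t * (LINT x:{0<..}|lborel. (1 - exp (- \<mu> * x)) * nu_T C G M Y x)"
    by (simp add: set_lebesgue_integral_def)
  finally have "p + q = t * (LINT x:{0<..}|lborel. (1 - exp (- \<mu> * x)) * nu_T C G M Y x)"
    using pq by (simp del: ennreal_plus)
  moreover have "laplace P \<mu> = exp (- t * (LINT x:{0<..}|lborel. (1 - exp (- \<mu> * x)) * nu_T C G M Y x))"
    using P \<mu> by (simp add: subordinator_law_def)
  ultimately have "laplace P \<mu> = exp (- p) * exp (- q)" by (simp flip: exp_add)
  then show "laplace (thorin_law {0<..L} \<star> thorin_law {L<..}) \<mu> = laplace P \<mu>"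
    using \<mu> by (simp add: laplace_convolution[OF laws] lap)
qed

text \<open>The prefactor is the total mass of \<open>mixing {0<..L}\<close>, namely c times the
  integral of z^(Y/2 - 1) over (0, L]. Dividing by it turns the first coordinate into Z, independent
  of the ratio.\<close>

lemma ln_laplace_R_law:
  assumes L: "0 < L" and \<mu>: "0 < \<mu>"
  shows "- ln (laplace (thorin_law {0<..L}) \<mu>) = 2 * c * L powr (Y/2) / Y * (\<integral>r. ln (1 + \<mu> * r) \<partial>R_law G M Y L)"
proof -
  have A: "{0<..L} \<in> sets borel" "{0<..L} \<subseteq> {0<..}" using L by auto
  let ?d = "\<lambda>z. indicator {0..L} z * (Y/2) * L powr (- Y/2) * z powr (Y/2 - 1)"
  let ?k = "2 * c * L powr (Y/2) / Y"
  have k: "0 \<le> ?k" using c_pos Y by auto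
  have sets_Z[measurable_cong]: "sets (Z_law Y L) = sets borel" by (simp add: Z_law_def)
  have sf_Z: "sigma_finite_measure (Z_law Y L)"
    unfolding Z_law_def by (subst sigma_finite_measure.sigma_finite_iff_density_finite[OF sigma_finite_lborel]) auto
  interpret Z: sigma_finite_measure "Z_law Y L" by fact
  interpret RZ: pair_sigma_finite "ratio_law Y" "Z_law Y L" ..
  have meas: "(\<lambda>(r, z). 1 / ((G * M + ((G + M) / 2)\<^sup>2 * r) / 2 + z)) \<in> borel_measurable (ratio_law Y \<Otimes>\<^sub>M Z_law Y L)"
    by measurable
  have R_eq: "(G * M + ((G + M) / 2)\<^sup>2 * r) / 2 + z = rate (z, r)" for z r
    by (simp add: rate_def shift_def)
  have "AE p in ratio_law Y \<Otimes>\<^sub>M Z_law Y L. 0 \<le> 1 / rate (snd p, fst p)"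
  proof (rule RZ.AE_pair_measure)
    have "AE z in Z_law Y L. 0 \<le> z" unfolding Z_law_def by (subst AE_density) (auto split: split_indicator)
    then show "AE r in ratio_law Y. AE z in Z_law Y L. 0 \<le> 1 / rate (snd (r, z), fst (r, z))"
      using AE_ratio_nonneg by (auto elim!: eventually_mono simp: rate_def shift_nonneg)
  qed measurable
  then have AE_R: "AE r in R_law G M Y L. 0 \<le> r"
    unfolding R_law_def by (subst AE_distr_iff[OF meas]) (auto simp: R_eq case_prod_beta')
  have "ennreal ?k * (\<integral>\<^sup>+r. ennreal (ln (1 + \<mu> * r)) \<partial>R_law G M Y L) =
      ennreal ?k * (\<integral>\<^sup>+p. ennreal (ln (1 + \<mu> / rate (snd p, fst p))) \<partial>(ratio_law Y \<Otimes>\<^sub>M Z_law Y L))"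
    unfolding R_law_def by (subst nn_integral_distr[OF meas]) (auto simp: R_eq case_prod_beta')
  also have "\<dots> = ennreal ?k * (\<integral>\<^sup>+z. \<integral>\<^sup>+r. ennreal (ln (1 + \<mu> / rate (z, r))) \<partial>ratio_law Y \<partial>Z_law Y L)"
    by (subst RZ.nn_integral_snd[symmetric]) auto
  also have "\<dots> = (\<integral>\<^sup>+z. ennreal ?k * (ennreal (?d z) * (\<integral>\<^sup>+r. ennreal (ln (1 + \<mu> / rate (z, r))) \<partial>ratio_law Y)) \<partial>lborel)"
    unfolding Z_law_def by (subst nn_integral_density) (auto simp: nn_integral_cmult)
  also have "\<dots> = (\<integral>\<^sup>+z. ennreal (indicator {0<..L} z * (c * z powr (Y/2 - 1))) * (\<integral>\<^sup>+r. ennreal (ln (1 + \<mu> / rate (z, r))) \<partial>ratio_law Y) \<partial>lborel)"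
  proof (rule nn_integral_cong)
    fix z :: real
    have "L powr (Y/2) * L powr (- Y/2) = 1" using L by (simp flip: powr_add)
    moreover have "?k * ?d z = (L powr (Y/2) * L powr (- Y/2)) * (indicator {0..L} z * (c * z powr (Y/2 - 1)))"
      using Y by (simp add: field_simps)
    \<comment> \<open>The intervals differ at the endpoint 0, but \<open>0 powr _ = 0\<close> makes
      the two densities agree there as well.\<close>
    ultimately have "?k * ?d z = indicator {0<..L} z * (c * z powr (Y/2 - 1))"
      by (cases "z = 0") (auto split: split_indicator)
    then have "ennreal ?k * ennreal (?d z) = ennreal (indicator {0<..L} z * (c * z powr (Y/2 - 1)))"
      using ennreal_mult'[OF k] by metis
    then show "ennreal ?k * (ennreal (?d z) * (\<integral>\<^sup>+r. ennreal (ln (1 + \<mu> / rate (z, r))) \<partial>ratio_law Y)) =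
        ennreal (indicator {0<..L} z * (c * z powr (Y/2 - 1))) * (\<integral>\<^sup>+r. ennreal (ln (1 + \<mu> / rate (z, r))) \<partial>ratio_law Y)"
      by (simp only: mult.assoc[symmetric])
  qed
  also have "\<dots> = (\<integral>\<^sup>+v. ennreal (ln (1 + \<mu> / rate v)) \<partial>mixing {0<..L})"
    by (rule nn_integral_mixing[symmetric]) auto
  also have "\<dots> = ennreal (- ln (laplace (thorin_law {0<..L}) \<mu>))"
    by (rule ln_laplace_thorin_law(2)[OF A \<mu>, symmetric])
  finally have "- ln (laplace (thorin_law {0<..L}) \<mu>) = enn2real (ennreal ?k * (\<integral>\<^sup>+r. ennreal (ln (1 + \<mu> * r)) \<partial>R_law G M Y L))"
    using ln_laplace_thorin_law(1)[OF A \<mu>] by simp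
  also have "\<dots> = ?k * enn2real (\<integral>\<^sup>+r. ennreal (ln (1 + \<mu> * r)) \<partial>R_law G M Y L)"
    using k by (simp add: enn2real_mult)
  also have "enn2real (\<integral>\<^sup>+r. ennreal (ln (1 + \<mu> * r)) \<partial>R_law G M Y L) = (\<integral>r. ln (1 + \<mu> * r) \<partial>R_law G M Y L)"
    using AE_R \<mu> by (subst integral_eq_nn_integral) (auto simp: R_law_def elim!: eventually_mono)
  finally show ?thesis .
qed

section \<open>Moments of the remainder\<close>

text \<open>Discarding the nonnegative shift gives rate >= z, and the integral of z^(Y/2 - 2 - k)
  over z > L converges for every k because Y < 2.\<close>

lemma inverse_moment_le:
  assumes L: "0 < L"
  shows "(\<integral>\<^sup>+v. ennreal (1 / rate v ^ Suc k) \<partial>mixing {L<..}) \<le> ennreal (c * (L powr (Y/2 - Suc k) / (Suc k - Y/2)))"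
proof -
  have "(\<integral>\<^sup>+v. ennreal (1 / rate v ^ Suc k) \<partial>mixing {L<..}) =
      (\<integral>\<^sup>+z. ennreal (indicator {L<..} z * (c * z powr (Y/2 - 1))) * (\<integral>\<^sup>+r. ennreal (1 / rate (z, r) ^ Suc k) \<partial>ratio_law Y) \<partial>lborel)"
    by (rule nn_integral_mixing) auto
  also have "\<dots> \<le> (\<integral>\<^sup>+z. ennreal c * ennreal (indicator {L<..} z * z powr (Y/2 - 1 - Suc k)) \<partial>lborel)"
  proof (rule nn_integral_mono)
    fix z :: real
    show "ennreal (indicator {L<..} z * (c * z powr (Y/2 - 1))) * (\<integral>\<^sup>+r. ennreal (1 / rate (z, r) ^ Suc k) \<partial>ratio_law Y)
        \<le> ennreal c * ennreal (indicator {L<..} z * z powr (Y/2 - 1 - Suc k))"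
    proof (cases "L < z")
      case True
      have "(\<integral>\<^sup>+r. ennreal (1 / rate (z, r) ^ Suc k) \<partial>ratio_law Y) \<le> (\<integral>\<^sup>+r. ennreal (1 / z ^ Suc k) \<partial>ratio_law Y)"
      proof (rule nn_integral_mono_AE, use AE_ratio_nonneg in eventually_elim)
        case (elim r)
        then have "z ^ Suc k \<le> rate (z, r) ^ Suc k"
          using True L shift_nonneg[of r] by (intro power_mono) (auto simp: rate_def)
        then show ?case using True L by (intro ennreal_leI frac_le) auto
      qed
      also have "\<dots> = ennreal (1 / z ^ Suc k)" using R.emeasure_space_1 by simp
      finally have "ennreal (c * z powr (Y/2 - 1)) * (\<integral>\<^sup>+r. ennreal (1 / rate (z, r) ^ Suc k) \<partial>ratio_law Y)
          \<le> ennreal (c * z powr (Y/2 - 1)) * ennreal (1 / z ^ Suc k)" by (rule mult_left_mono) simp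
      also have "\<dots> = ennreal (c * z powr (Y/2 - 1) * (1 / z ^ Suc k))"
        using c_pos by (intro ennreal_mult'[symmetric]) simp
      also have "c * z powr (Y/2 - 1) * (1 / z ^ Suc k) = c * z powr (Y/2 - 1 - Suc k)"
        using True L powr_realpow[of z "Suc k"] powr_diff[of z "Y/2 - 1" "real (Suc k)"]
        by (simp del: power_Suc of_nat_Suc)
      also have "ennreal \<dots> = ennreal c * ennreal (z powr (Y/2 - 1 - Suc k))"
        using c_pos by (intro ennreal_mult') simp
      finally show ?thesis using True by simp
    qed simp
  qed
  also have "\<dots> = ennreal c * ennreal (L powr (Y/2 - 1 - Suc k + 1) / (- (Y/2 - 1 - Suc k) - 1))"
    using L Y by (subst nn_integral_cmult; (subst nn_integral_powr_to_inf)?) auto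
  also have "\<dots> = ennreal (c * (L powr (Y/2 - Suc k) / (Suc k - Y/2)))"
    using c_pos by (subst ennreal_mult'[symmetric]) (auto simp: algebra_simps)
  finally show ?thesis .
qed

text \<open>\<open>r0\<close> is chosen so that the ratio stays below it with probability over 1/2.
  Once L >= \<open>shift r0\<close>, these ratios satisfy rate <= 2 z for all z > L, and 1/8 is this
  probability bound times the factor 1/4 from the square. The \<open>max 1\<close> in
  \<open>K\<close> keeps the threshold positive.\<close>

lemma second_inverse_moment_ge:
  obtains K where "0 < K" "\<And>L. K \<le> L \<Longrightarrow>
    ennreal (c / 8 * (L powr (Y/2 - 2) / (2 - Y/2))) \<le> (\<integral>\<^sup>+v. ennreal (1 / rate v ^ 2) \<partial>mixing {L<..})"
proof -
  have "\<forall>\<^sub>F r in at_top. 1 / 2 < cdf (ratio_law Y) r"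
    using R.cdf_lim_at_top_prob by (rule order_tendstoD) simp
  then obtain r0 where r0: "1 / 2 < measure (ratio_law Y) {..r0}"
    by (auto simp: cdf_def eventually_at_top_linorder)
  define K where "K = max 1 (shift r0)"
  have "ennreal (c / 8 * (L powr (Y/2 - 2) / (2 - Y/2))) \<le> (\<integral>\<^sup>+v. ennreal (1 / rate v ^ 2) \<partial>mixing {L<..})" if "K \<le> L" for L
  proof -
    have L: "0 < L" "shift r0 \<le> L" using that by (auto simp: K_def)
    have "ennreal (c / 8 * (L powr (Y/2 - 2) / (2 - Y/2))) =
        ennreal (c / 8) * ennreal (L powr (Y/2 - 3 + 1) / (- (Y/2 - 3) - 1))"
      using c_pos by (subst ennreal_mult'[symmetric]) auto
    also have "\<dots> = (\<integral>\<^sup>+z. ennreal (c / 8) * ennreal (indicator {L<..} z * z powr (Y/2 - 3)) \<partial>lborel)"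
      using L Y by (subst nn_integral_cmult; (subst nn_integral_powr_to_inf)?) auto
    also have "\<dots> \<le> (\<integral>\<^sup>+z. ennreal (indicator {L<..} z * (c * z powr (Y/2 - 1))) * (\<integral>\<^sup>+r. ennreal (1 / rate (z, r) ^ 2) \<partial>ratio_law Y) \<partial>lborel)"
    proof (rule nn_integral_mono)
      fix z :: real
      show "ennreal (c / 8) * ennreal (indicator {L<..} z * z powr (Y/2 - 3)) \<le>
          ennreal (indicator {L<..} z * (c * z powr (Y/2 - 1))) * (\<integral>\<^sup>+r. ennreal (1 / rate (z, r) ^ 2) \<partial>ratio_law Y)"
      proof (cases "L < z")
        case True
        have "ennreal (1 / (2 * z) ^ 2) * ennreal (1 / 2) \<le> ennreal (1 / (2 * z) ^ 2) * emeasure (ratio_law Y) {..r0}"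
          unfolding R.emeasure_eq_measure using r0 by (intro mult_left_mono ennreal_leI) auto
        also have "\<dots> = (\<integral>\<^sup>+r. ennreal (1 / (2 * z) ^ 2) * indicator {..r0} r \<partial>ratio_law Y)"
          by (subst nn_integral_cmult_indicator) auto
        also have "\<dots> \<le> (\<integral>\<^sup>+r. ennreal (1 / rate (z, r) ^ 2) \<partial>ratio_law Y)"
        proof (rule nn_integral_mono_AE, use AE_ratio_nonneg in eventually_elim)
          case (elim r)
          show ?case
          proof (cases "r \<le> r0")
            case le: True
            then have "shift r \<le> shift r0" by (auto simp: shift_def intro!: mult_left_mono divide_right_mono)
            then have "rate (z, r) \<le> 2 * z" "0 < rate (z, r)"
              using True L shift_nonneg[OF elim] by (auto simp: rate_def)
            then have "1 / (2 * z) ^ 2 \<le> 1 / rate (z, r) ^ 2"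
              by (intro frac_le power_mono zero_less_power) auto
            then show ?thesis using le by (simp only: indicator_simps atMost_iff mult_1_right ennreal_leI)
          qed simp
        qed
        finally have le: "ennreal (1 / (2 * z) ^ 2) * ennreal (1 / 2) \<le> (\<integral>\<^sup>+r. ennreal (1 / rate (z, r) ^ 2) \<partial>ratio_law Y)" .
        have "z powr (Y/2 - 3) = z powr (Y/2 - 1) / z ^ 2"
          using True L powr_realpow[of z 2] powr_diff[of z "Y/2 - 1" 2] by simp
        then have eq: "c / 8 * z powr (Y/2 - 3) = c * z powr (Y/2 - 1) * (1 / (2 * z) ^ 2 * (1 / 2))"
          by (simp add: power_mult_distrib field_simps)
        have "ennreal (c / 8) * ennreal (z powr (Y/2 - 3)) = ennreal (c / 8 * z powr (Y/2 - 3))"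
          using c_pos by (intro ennreal_mult'[symmetric]) simp
        also have "\<dots> = ennreal (c * z powr (Y/2 - 1)) * ennreal (1 / (2 * z) ^ 2 * (1 / 2))"
          unfolding eq using c_pos by (intro ennreal_mult') simp
        also have "ennreal (1 / (2 * z) ^ 2 * (1 / 2)) = ennreal (1 / (2 * z) ^ 2) * ennreal (1 / 2)"
          by (intro ennreal_mult') simp
        also have "ennreal (c * z powr (Y/2 - 1)) * (ennreal (1 / (2 * z) ^ 2) * ennreal (1 / 2))
            \<le> ennreal (c * z powr (Y/2 - 1)) * (\<integral>\<^sup>+r. ennreal (1 / rate (z, r) ^ 2) \<partial>ratio_law Y)"
          using le by (rule mult_left_mono) simp
        finally show ?thesis using True by simp
      qed simp
    qed
    also have "\<dots> = (\<integral>\<^sup>+v. ennreal (1 / rate v ^ 2) \<partial>mixing {L<..})"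
      by (rule nn_integral_mixing[symmetric]) auto
    finally show ?thesis .
  qed
  moreover have "0 < K" by (simp add: K_def)
  ultimately show ?thesis by (rule that[rotated])
qed

lemma tail_moment:
  assumes L: "0 < L"
  shows "integrable (thorin_levy_measure (mixing {L<..}) rate) (\<lambda>x. x ^ Suc k)"
    "(\<integral>x. x ^ Suc k \<partial>thorin_levy_measure (mixing {L<..}) rate) \<le> fact k * (c * (L powr (Y/2 - Suc k) / (Suc k - Y/2)))"
proof -
  interpret thorin_data "mixing {L<..}" rate using L by (intro thorin_data_mixing) auto
  have fin: "(\<integral>\<^sup>+v. ennreal (1 / rate v ^ Suc k) \<partial>mixing {L<..}) < \<infinity>"
    using inverse_moment_le[OF L, of k] by (auto intro: order.strict_trans1)
  show "integrable \<nu> (\<lambda>x. x ^ Suc k)" by (rule integrable_power(1)[OF fin])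
  have "ennreal (\<integral>x. x ^ Suc k \<partial>\<nu>) \<le> ennreal (fact k) * ennreal (c * (L powr (Y/2 - Suc k) / (Suc k - Y/2)))"
    unfolding integrable_power(2)[OF fin] by (intro mult_left_mono inverse_moment_le[OF L]) auto
  also have "\<dots> = ennreal (fact k * (c * (L powr (Y/2 - Suc k) / (Suc k - Y/2))))"
    by (intro ennreal_mult'[symmetric]) simp
  finally show "(\<integral>x. x ^ Suc k \<partial>\<nu>) \<le> fact k * (c * (L powr (Y/2 - Suc k) / (Suc k - Y/2)))"
    using c_pos Y by (subst (asm) ennreal_le_iff) auto
qed

lemma tail_law_moments:
  assumes L: "0 < L"
  defines "\<nu> \<equiv> thorin_levy_measure (mixing {L<..}) rate"
  shows "mean (thorin_law {L<..}) = (\<integral>x. x \<partial>\<nu>)" "var (thorin_law {L<..}) = (\<integral>x. x\<^sup>2 \<partial>\<nu>)"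
    "(\<integral>\<^sup>+x. ennreal (x\<^sup>2) \<partial>thorin_law {L<..}) = ennreal ((\<integral>x. x \<partial>\<nu>)\<^sup>2 + (\<integral>x. x\<^sup>2 \<partial>\<nu>))"
proof -
  have A: "{L<..} \<in> sets borel" "{L<..} \<subseteq> {0<..}" using L by auto
  interpret P: real_distribution "thorin_law {L<..}"
    using nonneg_thorin_law[OF A] by (rule nonneg_law_real_distribution)
  interpret T: thorin "mixing {L<..}" rate using A by (rule thorin_mixing)
  have int: "integrable \<nu> (\<lambda>x. x)" "integrable \<nu> (\<lambda>x. x\<^sup>2)"
    using tail_moment(1)[OF L, of 0] tail_moment(1)[OF L, of 1] by (simp_all add: \<nu>_def power2_eq_square)
  have sets: "sets \<nu> = sets borel" by (simp add: \<nu>_def)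
  have lap: "laplace (thorin_law {L<..}) \<mu> = exp (- (\<integral>x. 1 - exp (- (\<mu> * x)) \<partial>\<nu>))" if "0 < \<mu>" for \<mu>
    using laplace_thorin_law[OF A that] unfolding \<nu>_def .
  have moments: "integrable (thorin_law {L<..}) (\<lambda>x. x)" "(\<integral>x. x \<partial>thorin_law {L<..}) = (\<integral>x. x \<partial>\<nu>)"
    "integrable (thorin_law {L<..}) (\<lambda>x. x\<^sup>2)" "(\<integral>x. x\<^sup>2 \<partial>thorin_law {L<..}) = (\<integral>x. x \<partial>\<nu>)\<^sup>2 + (\<integral>x. x\<^sup>2 \<partial>\<nu>)"
    by (intro levy_khintchine_moments[OF nonneg_thorin_law[OF A] sets lap T.AE_pos[folded \<nu>_def] int]; assumption)+
  show mean: "mean (thorin_law {L<..}) = (\<integral>x. x \<partial>\<nu>)"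
    using moments(2) by (simp add: mean_def)
  have "var (thorin_law {L<..}) = (\<integral>x. x\<^sup>2 \<partial>thorin_law {L<..}) - (\<integral>x. x \<partial>thorin_law {L<..})\<^sup>2"
    using P.variance_eq[of "\<lambda>x. x"] moments(1,3) by (simp add: var_def mean_def)
  then show "var (thorin_law {L<..}) = (\<integral>x. x\<^sup>2 \<partial>\<nu>)"
    using moments(2,4) by simp
  show "(\<integral>\<^sup>+x. ennreal (x\<^sup>2) \<partial>thorin_law {L<..}) = ennreal ((\<integral>x. x \<partial>\<nu>)\<^sup>2 + (\<integral>x. x\<^sup>2 \<partial>\<nu>))"
    unfolding moments(4)[symmetric] using moments(3) by (intro nn_integral_eq_integral) auto
qed

text \<open>The two summands bound the squared mean and the variance of the remainder separately,
  that is, the square of its first cumulant and its second cumulant.\<close>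

lemma tail_second_moment_le:
  assumes L: "0 < L"
  shows "(\<integral>\<^sup>+x. ennreal (x\<^sup>2) \<partial>thorin_law {L<..}) \<le>
    ennreal (c\<^sup>2 / ((1 - Y/2)\<^sup>2 * L powr (2 - Y)) + c / ((2 - Y/2) * L powr (2 - Y/2)))"
proof -
  let ?\<nu> = "thorin_levy_measure (mixing {L<..}) rate"
  interpret T: thorin "mixing {L<..}" rate using L by (intro thorin_mixing) auto
  have m1: "0 \<le> (\<integral>x. x \<partial>?\<nu>)" using T.AE_pos by (intro integral_nonneg_AE) (auto elim: eventually_mono)
  have "(\<integral>x. x \<partial>?\<nu>)\<^sup>2 \<le> (c * (L powr (Y/2 - 1) / (1 - Y/2)))\<^sup>2"
    using tail_moment(2)[OF L, of 0] m1 by (intro power_mono) auto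
  also have "\<dots> = c\<^sup>2 / ((1 - Y/2)\<^sup>2 * L powr (2 - Y))"
  proof -
    have "(L powr (Y/2 - 1))\<^sup>2 = 1 / L powr (2 - Y)"
      using L by (simp add: power2_eq_square powr_minus_divide[symmetric] flip: powr_add)
    then show ?thesis by (simp add: power_mult_distrib power_divide)
  qed
  finally have "(\<integral>x. x \<partial>?\<nu>)\<^sup>2 \<le> c\<^sup>2 / ((1 - Y/2)\<^sup>2 * L powr (2 - Y))" .
  moreover have "(\<integral>x. x\<^sup>2 \<partial>?\<nu>) \<le> c / ((2 - Y/2) * L powr (2 - Y/2))"
  proof -
    have "L powr (Y/2 - 2) = 1 / L powr (2 - Y/2)" by (simp flip: powr_minus_divide)
    then show ?thesis using tail_moment(2)[OF L, of 1] by (simp add: numeral_2_eq_2 power2_eq_square mult.commute)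
  qed
  ultimately show ?thesis
    unfolding tail_law_moments(3)[OF L] by (intro ennreal_leI add_mono)
qed

text \<open>The third cumulant is at most of order L^(Y/2 - 3) and the variance at least of order
  L^(Y/2 - 2); the exponent of the quotient is (Y/2 - 3) - (3/2)(Y/2 - 2) = - Y/4.\<close>

lemma tail_skewness_bound:
  obtains K D where "0 < K" and "\<And>L. K \<le> L \<Longrightarrow> 0 < var (thorin_law {L<..})"
    and "\<And>L. K \<le> L \<Longrightarrow>
      (\<integral>x. x ^ 3 \<partial>thorin_levy_measure (mixing {L<..}) rate) / sqrt (var (thorin_law {L<..})) ^ 3 \<le> D * L powr (- Y/4)"
proof -
  obtain K where K: "0 < K" "\<And>L. K \<le> L \<Longrightarrow>
      ennreal (c / 8 * (L powr (Y/2 - 2) / (2 - Y/2))) \<le> (\<integral>\<^sup>+v. ennreal (1 / rate v ^ 2) \<partial>mixing {L<..})"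
    by (rule second_inverse_moment_ge) blast
  define b where "b = c / 8 / (2 - Y/2)"
  have b: "0 < b" using c_pos Y by (simp add: b_def)
  \<comment> \<open>The 2 is \<open>fact 2\<close> from the third moment, and \<open>b\<close> is
    the constant in the lower bound for the variance, raised to the power 3/2 by the cubed standard
    deviation.\<close>
  define D where "D = 2 * (c / (3 - Y/2)) / b powr (3/2)"
  have var_ge: "b * L powr (Y/2 - 2) \<le> var (thorin_law {L<..})" if "K \<le> L" for L
  proof -
    have L: "0 < L" using K(1) that by linarith
    interpret T: thorin "mixing {L<..}" rate using L by (intro thorin_mixing) auto
    have fin: "(\<integral>\<^sup>+v. ennreal (1 / rate v ^ Suc 1) \<partial>mixing {L<..}) < \<infinity>"
      using inverse_moment_le[OF L, of 1] by (auto intro: order.strict_trans1)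
    have "ennreal (b * L powr (Y/2 - 2)) \<le> ennreal (\<integral>x. x\<^sup>2 \<partial>T.\<nu>)"
      using K(2)[OF that] T.integrable_power(2)[OF fin] by (simp add: b_def numeral_2_eq_2)
    moreover have "0 \<le> (\<integral>x. x\<^sup>2 \<partial>T.\<nu>)" by (rule Bochner_Integration.integral_nonneg) simp
    ultimately show ?thesis unfolding tail_law_moments(2)[OF L] by (simp add: ennreal_le_iff)
  qed
  have var_pos: "0 < var (thorin_law {L<..})" if "K \<le> L" for L
  proof -
    have "0 < b * L powr (Y/2 - 2)" using b K(1) that by simp
    with var_ge[OF that] show ?thesis by linarith
  qed
  have "(\<integral>x. x ^ 3 \<partial>thorin_levy_measure (mixing {L<..}) rate) / sqrt (var (thorin_law {L<..})) ^ 3 \<le> D * L powr (- Y/4)"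
    if "K \<le> L" for L
  proof -
    have L: "0 < L" using K(1) that by linarith
    define V where "V = var (thorin_law {L<..})"
    have V: "0 < V" unfolding V_def by (rule var_pos[OF that])
    have sqrt_V: "sqrt V ^ 3 = V powr (3/2)"
      using V by (simp add: powr_half_sqrt[symmetric] powr_realpow[symmetric] powr_powr)
    have "b powr (3/2) * L powr (3 * Y/4 - 3) = (b * L powr (Y/2 - 2)) powr (3/2)"
      using b L by (simp add: powr_mult powr_powr field_simps)
    also have "\<dots> \<le> V powr (3/2)"
      using var_ge[OF that] b L by (intro powr_mono2) (auto simp: V_def)
    finally have low: "b powr (3/2) * L powr (3 * Y/4 - 3) \<le> sqrt V ^ 3" unfolding sqrt_V .
    have up: "(\<integral>x. x ^ 3 \<partial>thorin_levy_measure (mixing {L<..}) rate) \<le> 2 * (c * (L powr (Y/2 - 3) / (3 - Y/2)))"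
      using tail_moment(2)[OF L, of 2] by (simp add: eval_nat_numeral)
    have "(\<integral>x. x ^ 3 \<partial>thorin_levy_measure (mixing {L<..}) rate) / sqrt V ^ 3 \<le>
        2 * (c * (L powr (Y/2 - 3) / (3 - Y/2))) / (b powr (3/2) * L powr (3 * Y/4 - 3))"
      using up low b L c_pos Y by (intro frac_le) auto
    also have "\<dots> = D * (L powr (Y/2 - 3) / L powr (3 * Y/4 - 3))" by (simp add: D_def)
    also have "L powr (Y/2 - 3) / L powr (3 * Y/4 - 3) = L powr (- Y/4)"
      using L by (simp add: powr_diff[symmetric])
    finally show ?thesis unfolding V_def .
  qed
  with K(1) var_pos show ?thesis by (rule that)
qed

section \<open>Asymptotic normality of the remainder\<close>

lemma standardized_tail_tendsto_normal:
  assumes Ls: "filterlim Ls at_top sequentially"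
  shows "weak_conv_m (\<lambda>n. standardize (thorin_law {(if 0 < Ls n then Ls n else 1)<..})) std_normal_distribution"
proof (rule levy_continuity)
  \<comment> \<open>\<open>thorin_law\<close> is specified only for sets inside the positive
    half-line, while the continuity theorem asks for a distribution at every index. Finitely many
    terms of \<open>Ls\<close> may be nonpositive; the default 1 covers them and is eventually never
    taken.\<close>
  let ?l = "\<lambda>n. if 0 < Ls n then Ls n else 1"
  have A: "{?l n<..} \<in> sets borel" "{?l n<..} \<subseteq> {0<..}" for n by auto
  show "real_distribution (standardize (thorin_law {?l n<..}))" for n
  proof -
    interpret real_distribution "thorin_law {?l n<..}"
      using nonneg_thorin_law[OF A] by (rule nonneg_law_real_distribution)
    show ?thesis unfolding standardize_def by (intro real_distribution_distr) measurable
  qed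
  show "real_distribution std_normal_distribution" by (rule real_dist_normal_dist)
  fix u :: real
  obtain K D where K: "0 < K" and var_pos: "\<And>L. K \<le> L \<Longrightarrow> 0 < var (thorin_law {L<..})"
    and skew: "\<And>L. K \<le> L \<Longrightarrow>
      (\<integral>x. x ^ 3 \<partial>thorin_levy_measure (mixing {L<..}) rate) / sqrt (var (thorin_law {L<..})) ^ 3 \<le> D * L powr (- Y/4)"
    by (rule tail_skewness_bound) blast
  have "\<exists>z. char (standardize (thorin_law {L<..})) u = exp z \<and>
      norm (z - complex_of_real (- u\<^sup>2 / 2)) \<le> \<bar>u\<bar> ^ 3 / 6 * (D * L powr (- Y/4))" if KL: "K \<le> L" for L
  proof -
    have L: "0 < L" using K KL by linarith
    have B: "{L<..} \<in> sets borel" "{L<..} \<subseteq> {0<..}" using L by auto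
    interpret T: thorin "mixing {L<..}" rate using B by (rule thorin_mixing)
    have int: "integrable T.\<nu> (\<lambda>x. x)" "integrable T.\<nu> (\<lambda>x. x\<^sup>2)" "integrable T.\<nu> (\<lambda>x. x ^ 3)"
      using tail_moment(1)[OF L, of 0] tail_moment(1)[OF L, of 1] tail_moment(1)[OF L, of 2]
      by (simp_all add: eval_nat_numeral)
    obtain z where z: "char (standardize (thorin_law {L<..})) u = exp z"
      "norm (z - complex_of_real (- u\<^sup>2 / 2)) \<le> \<bar>u\<bar> ^ 3 / 6 * ((\<integral>x. x ^ 3 \<partial>T.\<nu>) / sqrt (var (thorin_law {L<..})) ^ 3)"
      using char_standardize[OF nonneg_thorin_law[OF B] sets_thorin_levy_measure char_thorin_law[OF B] T.AE_pos int
          tail_law_moments(1,2)[OF L] var_pos[OF KL], of u] by blast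
    note z(2)
    also have "\<bar>u\<bar> ^ 3 / 6 * ((\<integral>x. x ^ 3 \<partial>T.\<nu>) / sqrt (var (thorin_law {L<..})) ^ 3) \<le> \<bar>u\<bar> ^ 3 / 6 * (D * L powr (- Y/4))"
      by (intro mult_left_mono skew KL) simp
    finally show ?thesis using z(1) by blast
  qed
  then obtain z where z: "\<And>L. K \<le> L \<Longrightarrow> char (standardize (thorin_law {L<..})) u = exp (z L)"
    and z_bound: "\<And>L. K \<le> L \<Longrightarrow> norm (z L - complex_of_real (- u\<^sup>2 / 2)) \<le> \<bar>u\<bar> ^ 3 / 6 * (D * L powr (- Y/4))"
    by metis
  have "((\<lambda>L. L powr (- Y/4)) \<longlongrightarrow> 0) at_top"
    using Y by (intro tendsto_neg_powr filterlim_ident) auto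
  then have "((\<lambda>L. \<bar>u\<bar> ^ 3 / 6 * (D * L powr (- Y/4))) \<longlongrightarrow> \<bar>u\<bar> ^ 3 / 6 * (D * 0)) at_top"
    by (intro tendsto_intros)
  then have "((\<lambda>L. \<bar>u\<bar> ^ 3 / 6 * (D * L powr (- Y/4))) \<longlongrightarrow> 0) at_top" by simp
  moreover have "\<forall>\<^sub>F L in at_top. norm (z L - complex_of_real (- u\<^sup>2 / 2)) \<le> \<bar>u\<bar> ^ 3 / 6 * (D * L powr (- Y/4))"
    using eventually_ge_at_top[of K] by eventually_elim (rule z_bound)
  ultimately have "((\<lambda>L. z L - complex_of_real (- u\<^sup>2 / 2)) \<longlongrightarrow> 0) at_top"
    by (rule Lim_null_comparison[rotated])
  then have "(z \<longlongrightarrow> complex_of_real (- u\<^sup>2 / 2)) at_top" by (rule LIM_zero_cancel)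
  then have "((\<lambda>L. exp (z L)) \<longlongrightarrow> char std_normal_distribution u) at_top"
    unfolding char_std_normal_distribution exp_of_real[symmetric] by (rule tendsto_exp)
  from filterlim_compose[OF this Ls]
  have "(\<lambda>n. exp (z (Ls n))) \<longlonglongrightarrow> char std_normal_distribution u" .
  moreover have "\<forall>\<^sub>F n in sequentially. exp (z (Ls n)) = char (standardize (thorin_law {?l n<..})) u"
  proof -
    have "\<forall>\<^sub>F n in sequentially. K \<le> Ls n" using Ls by (simp add: filterlim_at_top)
    then show ?thesis by eventually_elim (use K in \<open>auto simp: z\<close>)
  qed
  ultimately show "(\<lambda>n. char (standardize (thorin_law {?l n<..})) u) \<longlonglongrightarrow> char std_normal_distribution u"
    by (rule Lim_transform_eventually)
qed

end

theorem theorem1: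
  fixes C G M Y t :: real and P :: "real measure"
  assumes "C > 0" and "G \<ge> 0" and "M \<ge> 0" and "0 < Y" and "Y < 2" and "t > 0"
    and "subordinator_law (nu_T C G M Y) t P"
  shows "\<exists>TL eps :: real \<Rightarrow> real measure.
    (\<forall>L>0.
       nonneg_law (TL L) \<and> nonneg_law (eps L) \<and>
       TL L \<star> eps L = P \<and>
       ggc (TL L) \<and>
       (\<forall>\<mu>>0. - ln (laplace (TL L) \<mu>) =
          2 * (t * C * 2 powr (Y/2 - 1) / Gamma Y) * L powr (Y/2) / Y
            * (\<integral>r. ln (1 + \<mu> * r) \<partial>R_law G M Y L)) \<and>
       (\<integral>\<^sup>+ x. ennreal (x\<^sup>2) \<partial>eps L) \<le>
          ennreal ((t * C * 2 powr (Y/2 - 1) / Gamma Y)\<^sup>2 / ((1 - Y/2)\<^sup>2 * L powr (2 - Y))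
                 + (t * C * 2 powr (Y/2 - 1) / Gamma Y) / ((2 - Y/2) * L powr (2 - Y/2)))) \<and>
    (\<forall>Ls :: nat \<Rightarrow> real. filterlim Ls at_top sequentially \<longrightarrow>
       weak_conv_m (\<lambda>n. standardize (eps (Ls n))) (density lborel std_normal_density))"
proof -
  interpret cgmy C G M Y t using assms(1-6) by unfold_locales
  show ?thesis
  \<comment> \<open>The remainder is made a law at every real argument, as the limit statement
    quantifies over sequences that may start with nonpositive terms; for L > 0 the conditional
    reduces to L.\<close>
  proof (rule exI[of _ "\<lambda>L. thorin_law {0<..L}"], rule exI[of _ "\<lambda>L. thorin_law {(if 0 < L then L else 1)<..}"],
      intro conjI allI impI)
    fix L :: real assume L: "0 < L"
    then have A: "{0<..L} \<in> sets borel" "{0<..L} \<subseteq> {0<..}" and B: "{L<..} \<in> sets borel" "{L<..} \<subseteq> {0<..}"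
      by auto
    show "nonneg_law (thorin_law {0<..L})" "ggc (thorin_law {0<..L})"
      using nonneg_thorin_law[OF A] ggc_thorin_law[OF A] by auto
    show "nonneg_law (thorin_law {(if 0 < L then L else 1)<..})" using nonneg_thorin_law[OF B] L by simp
    show "thorin_law {0<..L} \<star> thorin_law {(if 0 < L then L else 1)<..} = P"
      using thorin_law_convolution[OF assms(7) L] L by simp
    show "- ln (laplace (thorin_law {0<..L}) \<mu>) = 2 * (t * C * 2 powr (Y/2 - 1) / Gamma Y) * L powr (Y/2) / Y
        * (\<integral>r. ln (1 + \<mu> * r) \<partial>R_law G M Y L)" if "0 < \<mu>" for \<mu>
      using ln_laplace_R_law[OF L that] unfolding c_def .
    show "(\<integral>\<^sup>+ x. ennreal (x\<^sup>2) \<partial>thorin_law {(if 0 < L then L else 1)<..}) \<le>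
        ennreal ((t * C * 2 powr (Y/2 - 1) / Gamma Y)\<^sup>2 / ((1 - Y/2)\<^sup>2 * L powr (2 - Y))
               + (t * C * 2 powr (Y/2 - 1) / Gamma Y) / ((2 - Y/2) * L powr (2 - Y/2)))"
      using tail_second_moment_le[OF L] L unfolding c_def by simp
  next
    fix Ls :: "nat \<Rightarrow> real" assume "filterlim Ls at_top sequentially"
    then show "weak_conv_m (\<lambda>n. standardize (thorin_law {(if 0 < Ls n then Ls n else 1)<..})) (density lborel std_normal_density)"
      by (rule standardized_tail_tendsto_normal)
  qed
qed

end
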